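(* Let $P_n(z)=a_n\prod_{k=1}^n(z-\alpha_{k,n})$, $n\in\mathbb{N}$, be a sequence of polynomials such that each $P_n$ has integer coefficients, exact degree $n$ (so $a_n\neq 0$), and only simple zeros in $\mathbb{C}$. Let $\tau_n=\frac1n\sum_{k=1}^n\delta_{\alpha_{k,n}}$ and suppose that $\tau_n\stackrel{*}{\rightarrow}\tau$ along a subsequence (infinite set) $\mathcal{N}\subset\mathbb{N}$. If $$H:=\limsup_{\mathcal{N}\ni n\to\infty}\left(M(P_n)\right)^{1/n}<\infty,$$ then $\tau$ is a unit measure (i.e. $\tau(\mathbb{C})=1$) with finite logarithmic energy $I[\tau]$. Furthermore, $$\int\log^+|z|\,d\tau(z)\le\log H,$$ and, for all but countably many $R>1$, the restriction $\tau_R:=\tau\vert_{\overline{D}_R}$, where $D_R:=\{z\in\mathbb{C}:|z|<R\}$, satisfies $$-\log 2-2\,\tau(\overline{D}_R)\log H\le I[\tau_R]\le (1-\tau(D_R))\log 4+2\log H.$$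
   Context: $\delta_\alpha$ denotes the unit point mass at $\alpha$. Weak* convergence $\tau_n\stackrel{*}{\rightarrow}\tau$ of positive Borel measures on $\mathbb{C}$ is tested against continuous functions with compact support in $\mathbb{C}$; so a priori the limit $\tau$ may have unbounded support and total mass less than $1$. The Mahler measure of $P_n(z)=a_n\prod_{k=1}^n(z-\alpha_{k,n})$ is $M(P_n)=\exp\left(\frac1{2\pi}\int_0^{2\pi}\log|P_n(e^{it})|\,dt\right)=|a_n|\prod_{k=1}^n\max(1,|\alpha_{k,n}|)$. The logarithmic energy of a positive Borel measure $\mu$ is $I[\mu]:=\iint\log\frac{1}{|z-t|}\,d\mu(z)\,d\mu(t)$. Here $\log^+x=\max(0,\log x)$, and $\overline{D}_R$ is the closure of $D_R$. *)

theory Defs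
  imports "HOL-Analysis.Analysis" "HOL-Probability.Giry_Monad"
    "HOL-Computational_Algebra.Polynomial"
begin

text \<open>
  The integrand is wrong (\<open>ln 0 = 0\<close> instead of \<open>-\<infinity>\<close>) only at the finitely many
  zeros of \<open>p\<close> on the unit circle, which does not affect the integral.
\<close>

definition mahler_measure :: "complex poly \<Rightarrow> real" where
  "mahler_measure p =
     exp (1 / (2 * pi) * (LBINT t:{0..2*pi}. ln (cmod (poly p (exp (\<i> * of_real t))))))"

definition normalized_counting_measure :: "nat \<Rightarrow> (nat \<Rightarrow> complex) \<Rightarrow> complex measure" where
  "normalized_counting_measure n \<alpha> = distr (uniform_count_measure {1..n}) borel \<alpha>"

lemma emeasure_normalized_counting_measure:
  assumes "n \<ge> 1" "A \<in> sets borel"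
  shows "emeasure (normalized_counting_measure n \<alpha>) A =
           ennreal (1 / real n) * (\<Sum>k = 1..n. emeasure (return borel (\<alpha> k)) A)"
proof -
  let ?U = "uniform_count_measure {1..n}"
  have "\<alpha> \<in> measurable ?U borel"
    by (simp add: measurable_def space_uniform_count_measure sets_uniform_count_measure)
  then have "emeasure (normalized_counting_measure n \<alpha>) A = emeasure ?U (\<alpha> -` A \<inter> space ?U)"
    unfolding normalized_counting_measure_def using assms(2) by (rule emeasure_distr)
  also have "\<alpha> -` A \<inter> space ?U = {k \<in> {1..n}. \<alpha> k \<in> A}"
    by (auto simp: space_uniform_count_measure)
  also have "emeasure ?U \<dots> = ennreal (real (card {k \<in> {1..n}. \<alpha> k \<in> A}) / real n)"
    by (subst emeasure_uniform_count_measure) auto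
  also have "\<dots> = ennreal (1 / real n) * of_nat (card {k \<in> {1..n}. \<alpha> k \<in> A})"
    by (simp add: ennreal_of_nat_eq_real_of_nat ennreal_mult[symmetric])
  also have "of_nat (card {k \<in> {1..n}. \<alpha> k \<in> A}) =
               (\<Sum>k = 1..n. emeasure (return borel (\<alpha> k)) A)"
    using assms by (simp add: indicator_def sum.If_cases Int_def)
  finally show ?thesis .
qed

definition weak_star_tendsto ::
    "('i \<Rightarrow> complex measure) \<Rightarrow> complex measure \<Rightarrow> 'i filter \<Rightarrow> bool" where
  "weak_star_tendsto \<mu> \<nu> F \<longleftrightarrow>
     (\<forall>f :: complex \<Rightarrow> real. continuous_on UNIV f \<longrightarrow> compact (closure {z. f z \<noteq> 0}) \<longrightarrow>
        ((\<lambda>i. \<integral>z. f z \<partial>\<mu> i) \<longlongrightarrow> (\<integral>z. f z \<partial>\<nu>)) F)"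

text \<open>The diagonal is treated separately since \<open>ln (1 / 0) = 0\<close>; point masses must have infinite energy.\<close>

definition log_kernel :: "complex \<Rightarrow> complex \<Rightarrow> ereal" where
  "log_kernel z t = (if z = t then \<infinity> else ereal (ln (1 / cmod (z - t))))"

text \<open>
  The integral of the positive part minus that of the negative part, \<open>e2ennreal\<close> being
  truncation at \<open>0\<close>. By the convention \<open>\<infinity> - \<infinity> = \<infinity>\<close> of \<^typ>\<open>ereal\<close>, the value is finite
  if and only if both parts are.
\<close>

definition log_energy :: "complex measure \<Rightarrow> ereal" where
  "log_energy \<mu> =
     enn2ereal (\<integral>\<^sup>+z. \<integral>\<^sup>+t. e2ennreal (log_kernel z t) \<partial>\<mu> \<partial>\<mu>) -
     enn2ereal (\<integral>\<^sup>+z. \<integral>\<^sup>+t. e2ennreal (- log_kernel z t) \<partial>\<mu> \<partial>\<mu>)"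

end

theory Submission
  imports "Jordan_Normal_Form.Determinant" "HOL-Complex_Analysis.Complex_Analysis"
    "HOL-Real_Asymp.Real_Asymp" Defs
begin

text \<open>
  The discriminant of \<open>P n\<close> is a nonzero integer, so the discrete energy
  \<open>\<Sum>\<^bsub>j\<noteq>k\<^esub> ln (1 / |\<alpha> j - \<alpha> k|)\<close> is at most \<open>2 n ln |a n|\<close>. By Jensen's formula
  \<open>ln |a n| + \<Sum> ln\<^sup>+ |\<alpha> k| = ln M(P n)\<close>, and this turns into the bound \<open>2 n ln M(P n)\<close> for
  the energy with respect to \<open>K(z, t) = ln (1 / |z - t|) + ln\<^sup>+ |z| + ln\<^sup>+ |t|\<close>. This kernel
  is bounded below by \<open>- ln 2\<close>, so truncating it and passing to the weak* limit gives
  \<open>\<integral>\<integral> K d\<tau> d\<tau> \<le> 2 ln H\<close>; no mass is lost because \<open>\<integral> ln\<^sup>+ |z|\<close> stays bounded along the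
  sequence. Both estimates for \<open>I[\<tau>\<^sub>R]\<close> follow from the nonnegativity of \<open>K + ln 2\<close>, for
  every \<open>R\<close>.
\<close>

section \<open>Discriminants of integer polynomials\<close>

text \<open>Weak* convergence tests only continuous functions of compact support, whereas
  \<open>ln (1 / |z - t|)\<close> is infinite on the diagonal and unbounded below at infinity, and
  \<open>\<tau>\<close> may a priori be unbounded. The shift by \<open>ln+\<close> repairs the
  behaviour at infinity because \<open>|z - t| \<le> 2 max(1, |z|) max(1, |t|)\<close>; this is the
  origin of \<open>ln 2\<close>. The same shift fits the arithmetic: in the sum over ordered pairs
  of zeros each \<open>ln+ |\<alpha> k|\<close> occurs about \<open>2 n\<close> times, which is also
  the factor of \<open>ln |a n|\<close> in the discriminant bound, so the two merge into the Mahler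
  measure. The diagonal is repaired by raising small distances to a fixed level: for the zeros this
  adds \<open>n\<close> diagonal terms to about \<open>n^2\<close> others, and they disappear after
  division by \<open>n^2\<close>. Restricting \<open>\<tau>\<close> can only decrease the double
  integral of a nonnegative kernel, so the two energy estimates reduce to elementary inequalities in
  the mass \<open>m\<close> of the restriction; \<open>ln 4\<close> arises from
  \<open>1 - m^2 \<le> 2 (1 - m)\<close>.\<close>

lemma pderiv_prod_linear_factor_at_root:
  fixes x :: "'b \<Rightarrow> 'a::idom"
  assumes "finite A" "k \<in> A"
  shows "poly (pderiv (\<Prod>j\<in>A. [:- x j, 1:])) (x k) = (\<Prod>j\<in>A - {k}. x k - x j)"
proof -
  have split: "(\<Prod>j\<in>A. [:- x j, 1:]) = [:- x k, 1:] * (\<Prod>j\<in>A - {k}. [:- x j, 1:])"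
    using assms by (rule prod.remove)
  show ?thesis
    by (simp add: split pderiv_mult pderiv_pCons poly_prod del: mult_pCons_left)
qed

lemma prod_symmetric_off_diagonal:
  fixes f :: "nat \<Rightarrow> nat \<Rightarrow> 'a::comm_monoid_mult"
  assumes sym: "\<And>i j. f i j = f j i"
  shows "(\<Prod>j<n. \<Prod>k\<in>{..<n} - {j}. f j k) = (\<Prod>j<n. \<Prod>i<j. f j i) * (\<Prod>j<n. \<Prod>i<j. f j i)"
proof (induction n)
  case (Suc n)
  have "(\<Prod>k\<in>{..<Suc n} - {j}. f j k) = f j n * (\<Prod>k\<in>{..<n} - {j}. f j k)" if "j < n" for j
  proof -
    have "{..<Suc n} - {j} = insert n ({..<n} - {j})" using that by auto
    then show ?thesis by simp
  qed
  moreover have "{..<Suc n} - {n} = {..<n}" by auto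
  ultimately show ?case
    by (simp add: prod.distrib Suc.IH sym[of _ n] ac_simps)
qed simp

text \<open>In the Newton basis \<open>q j\<close>, with roots \<open>x 0, ..., x (j - 1)\<close>,
  evaluation at the points is lower triangular, because \<open>q j\<close> vanishes at
  \<open>x k\<close> for \<open>k < j\<close>. The change of basis \<open>U\<close> is upper
  triangular with unit diagonal, each \<open>q j\<close> being monic of degree \<open>j\<close>, so
  it does not affect the determinant.\<close>

lemma det_vandermonde:
  fixes x :: "nat \<Rightarrow> 'a::idom"
  shows "Determinant.det (Matrix.mat n n (\<lambda>(k, i). x k ^ i)) = (\<Prod>j<n. \<Prod>i<j. x j - x i)"
proof -
  define q where "q j = (\<Prod>l<j. [:- x l, 1:])" for j
  define V U where "V = Matrix.mat n n (\<lambda>(k, i). x k ^ i)" and "U = Matrix.mat n n (\<lambda>(i, j). coeff (q j) i)"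
  have deg: "degree (q j) = j" for j
    unfolding q_def by (subst degree_prod_eq_sum_degree) auto
  have lead: "coeff (q j) j = 1" for j
  proof -
    have "lead_coeff (q j) = 1"
      unfolding q_def by (simp add: lead_coeff_prod)
    then show ?thesis by (simp add: deg)
  qed
  have VU: "V * U = Matrix.mat n n (\<lambda>(k, j). poly (q j) (x k))"
  proof (rule eq_matI)
    fix k j assume "k < dim_row (Matrix.mat n n (\<lambda>(k, j). poly (q j) (x k)))"
      "j < dim_col (Matrix.mat n n (\<lambda>(k, j). poly (q j) (x k)))"
    then have kj: "k < n" "j < n" by auto
    have "(V * U) $$ (k, j) = (\<Sum>i<n. x k ^ i * coeff (q j) i)"
      using kj by (simp add: V_def U_def scalar_prod_def atLeast0LessThan)
    also have "\<dots> = (\<Sum>i\<le>degree (q j). x k ^ i * coeff (q j) i)"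
      using kj by (intro sum.mono_neutral_right) (auto simp: deg coeff_eq_0)
    also have "\<dots> = poly (q j) (x k)"
      by (simp add: poly_altdef mult.commute)
    finally show "(V * U) $$ (k, j) = Matrix.mat n n (\<lambda>(k, j). poly (q j) (x k)) $$ (k, j)"
      using kj by simp
  qed (auto simp: V_def U_def)
  have "Determinant.det U = prod_list (diag_mat U)"
    by (rule det_upper_triangular[where n = n]) (auto simp: U_def upper_triangular_def coeff_eq_0 deg)
  then have detU: "Determinant.det U = 1"
    by (simp add: prod_list_diag_prod U_def lead)
  have "Determinant.det (V * U) = prod_list (diag_mat (V * U))"
  proof (rule det_lower_triangular[where n = n])
    fix i j assume "i < j" "j < n"
    then show "(V * U) $$ (i, j) = 0"
      by (auto simp: VU q_def poly_prod)
  qed (simp add: VU)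
  then have "Determinant.det (V * U) = (\<Prod>j<n. \<Prod>i<j. x j - x i)"
    by (simp add: prod_list_diag_prod VU q_def poly_prod atLeast0LessThan)
  moreover have "Determinant.det (V * U) = Determinant.det V * Determinant.det U"
    by (rule Determinant.det_mult[where n = n]) (auto simp: V_def U_def)
  ultimately show ?thesis
    by (simp add: detU V_def)
qed

lemma det_Ints:
  fixes A :: "'a::comm_ring_1 mat"
  assumes A: "A \<in> carrier_mat n n" and Ints: "\<And>i j. i < n \<Longrightarrow> j < n \<Longrightarrow> A $$ (i, j) \<in> \<int>"
  shows "Determinant.det A \<in> \<int>"
  unfolding det_def'[OF A]
proof (intro Ints_sum Ints_mult Ints_prod)
  fix p i assume "p \<in> {p. p permutes {0..<n}}" "i \<in> {0..<n}"
  then show "A $$ (i, p i) \<in> \<int>"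
    using permutes_in_image[of p "{0..<n}" i] by (intro Ints) auto
qed (auto simp: sign_def)

section \<open>Difference quotients and the Bezout matrix\<close>

lemma poly_as_cutoff_plus_shift:
  fixes p :: "'a::comm_semiring_1 poly"
  shows "p = poly_cutoff m p + monom 1 m * poly_shift m p"
  by (rule poly_eqI) (auto simp: coeff_poly_cutoff coeff_poly_shift coeff_monom_mult)

text \<open>As polynomials in \<open>y\<close>, these are the coefficients of \<open>x ^ r\<close>
  in the Bezoutian \<open>(p(x) q(y) - p(y) q(x)) / (x - y)\<close>. When \<open>p\<close> and
  \<open>q\<close> are split after degree \<open>r\<close>, the products of the two upper parts
  cancel, and each remaining product pairs an upper part of degree at most \<open>n - Suc r\<close>
  with a lower part of degree at most \<open>r\<close>. Hence the coefficients fit into an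
  \<open>n\<close> by \<open>n\<close> matrix.\<close>

lemma degree_bezout_row:
  fixes p q :: "'a::comm_ring_1 poly"
  assumes "degree p \<le> n" "degree q \<le> n" "r < n"
  shows "degree (poly_shift (Suc r) p * q - p * poly_shift (Suc r) q) < n"
proof -
  define T U where "T = poly_shift (Suc r) p" and "U = poly_shift (Suc r) q"
  define l m where "l = poly_cutoff (Suc r) p" and "m = poly_cutoff (Suc r) q"
  have dT: "degree T \<le> n - Suc r" and dU: "degree U \<le> n - Suc r"
    unfolding T_def U_def using assms
    by (auto intro!: degree_le simp: coeff_poly_shift coeff_eq_0)
  have dl: "degree l \<le> r" and dm: "degree m \<le> r"
    unfolding l_def m_def by (auto intro!: degree_le simp: coeff_poly_cutoff)
  have p: "p = l + monom 1 (Suc r) * T" and q: "q = m + monom 1 (Suc r) * U"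
    unfolding l_def T_def m_def U_def by (fact poly_as_cutoff_plus_shift)+
  have "T * q - p * U = T * m - l * U"
    by (subst p, subst q) (simp add: algebra_simps)
  moreover have "degree (T * m) \<le> (n - Suc r) + r" "degree (l * U) \<le> (n - Suc r) + r"
    using degree_mult_le[of T m] degree_mult_le[of l U] dT dU dl dm by linarith+
  ultimately have "degree (T * q - p * U) \<le> (n - Suc r) + r"
    by (metis degree_diff_le)
  then show ?thesis using assms(3) unfolding T_def U_def by linarith
qed

lemma poly_eq_sum_le_degree:
  fixes p :: "'a::comm_semiring_1 poly"
  assumes "degree p \<le> n"
  shows "poly p x = (\<Sum>i\<le>n. coeff p i * x ^ i)"
  unfolding poly_altdef using assms
  by (intro sum.mono_neutral_left) (auto simp: coeff_eq_0)

lemma poly_shift_eq_sum: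
  fixes p :: "'a::comm_ring_1 poly"
  assumes "degree p \<le> n"
  shows "poly (poly_shift (Suc r) p) y = (\<Sum>k\<le>n. if r < k then coeff p k * y ^ (k - Suc r) else 0)"
proof -
  have deg: "degree (poly_shift (Suc r) p) \<le> n"
    using assms by (auto intro!: degree_le simp: coeff_poly_shift coeff_eq_0)
  have "poly (poly_shift (Suc r) p) y = (\<Sum>i\<le>n. coeff p (i + Suc r) * y ^ i)"
    using deg by (subst poly_eq_sum_le_degree, assumption) (simp add: coeff_poly_shift)
  also have "\<dots> = (\<Sum>i | i \<le> n \<and> i + Suc r \<le> n. coeff p (i + Suc r) * y ^ i)"
    proof (intro sum.mono_neutral_right ballI)
    fix i assume "i \<in> {..n} - {i. i \<le> n \<and> i + Suc r \<le> n}"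
    then have "degree p < i + Suc r" using assms by auto
    then show "coeff p (i + Suc r) * y ^ i = 0" by (simp add: coeff_eq_0)
  qed auto
  also have "\<dots> = (\<Sum>k | k \<le> n \<and> r < k. coeff p k * y ^ (k - Suc r))"
    by (rule sum.reindex_bij_witness[of _ "\<lambda>k. k - Suc r" "\<lambda>i. i + Suc r"]) auto
  also have "\<dots> = (\<Sum>k\<le>n. if r < k then coeff p k * y ^ (k - Suc r) else 0)"
    by (simp add: sum.If_cases Int_def)
  finally show ?thesis .
qed

lemma sum_poly_shift:
  fixes p :: "'a::comm_ring_1 poly"
  assumes "degree p \<le> n"
  shows "(\<Sum>r<n. x ^ r * poly (poly_shift (Suc r) p) y) =
         (\<Sum>k\<le>n. coeff p k * (\<Sum>r<k. x ^ r * y ^ (k - Suc r)))"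
proof -
  have "(\<Sum>r<n. x ^ r * poly (poly_shift (Suc r) p) y) =
        (\<Sum>r<n. \<Sum>k\<le>n. if r < k then coeff p k * (x ^ r * y ^ (k - Suc r)) else 0)"
    using assms by (simp add: poly_shift_eq_sum sum_distrib_left if_distrib ac_simps cong: if_cong)
  also have "\<dots> = (\<Sum>k\<le>n. \<Sum>r<n. if r < k then coeff p k * (x ^ r * y ^ (k - Suc r)) else 0)"
    by (rule sum.swap)
  also have "\<dots> = (\<Sum>k\<le>n. \<Sum>r<k. coeff p k * (x ^ r * y ^ (k - Suc r)))"
  proof (rule sum.cong[OF refl])
    fix k assume "k \<in> {..n}"
    then have "{r \<in> {..<n}. r < k} = {..<k}" by auto
    then show "(\<Sum>r<n. if r < k then coeff p k * (x ^ r * y ^ (k - Suc r)) else 0) =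
          (\<Sum>r<k. coeff p k * (x ^ r * y ^ (k - Suc r)))"
      by (simp add: sum.If_cases Int_def)
  qed
  finally show ?thesis by (simp add: sum_distrib_left)
qed

text \<open>The values of \<open>poly_shift (Suc r) p\<close> at \<open>y\<close> are the
  coefficients of \<open>x ^ r\<close> in the difference quotient of \<open>p\<close>. At two
  distinct roots the quotient is zero, and this is what makes the Bezout matrix diagonal in the
  Vandermonde coordinates.\<close>

lemma sum_poly_shift_off_diagonal:
  fixes p :: "'a::comm_ring_1 poly"
  assumes "degree p \<le> n"
  shows "(x - y) * (\<Sum>r<n. x ^ r * poly (poly_shift (Suc r) p) y) = poly p x - poly p y"
proof -
  have *: "(x - y) * (\<Sum>r<k. x ^ r * y ^ (k - Suc r)) = x ^ k - y ^ k" for k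
    using power_diff_sumr2[of x k y] by (simp add: mult.commute)
  have "(x - y) * (\<Sum>k\<le>n. coeff p k * (\<Sum>r<k. x ^ r * y ^ (k - Suc r))) =
        (\<Sum>k\<le>n. coeff p k * ((x - y) * (\<Sum>r<k. x ^ r * y ^ (k - Suc r))))"
    by (simp add: sum_distrib_left ac_simps)
  then show ?thesis
    by (simp add: sum_poly_shift[OF assms] * poly_eq_sum_le_degree[OF assms] right_diff_distrib sum_subtractf)
qed

text \<open>On the diagonal the difference quotient turns into the derivative: the \<open>k\<close>
  products belonging to the coefficient of index \<open>k\<close> all equal
  \<open>x ^ (k - 1)\<close>.\<close>

lemma sum_poly_shift_diagonal:
  fixes p :: "'a::{comm_ring_1,semiring_no_zero_divisors,semiring_char_0} poly"
  assumes "degree p \<le> n"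
  shows "(\<Sum>r<n. x ^ r * poly (poly_shift (Suc r) p) x) = poly (pderiv p) x"
proof -
  have *: "(\<Sum>r<k. x ^ r * x ^ (k - Suc r)) = of_nat k * x ^ (k - 1)" for k
  proof -
    have "(\<Sum>r<k. x ^ r * x ^ (k - Suc r)) = (\<Sum>r<k. x ^ (k - 1))"
      by (intro sum.cong refl) (simp flip: power_add)
    then show ?thesis by simp
  qed
  have "poly (pderiv p) x = (\<Sum>k\<le>n. of_nat k * coeff p k * x ^ (k - 1))"
  proof -
    have "degree (pderiv p) \<le> n" using assms by (auto intro!: degree_le simp: coeff_pderiv coeff_eq_0)
    then have "poly (pderiv p) x = (\<Sum>k\<le>n. of_nat (Suc k) * coeff p (Suc k) * x ^ k)"
      by (subst poly_eq_sum_le_degree, assumption) (simp add: coeff_pderiv)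
    also have "\<dots> = (\<Sum>k<n. of_nat (Suc k) * coeff p (Suc k) * x ^ k)"
      using assms by (intro sum.mono_neutral_right) (auto intro!: coeff_eq_0)
    also have "\<dots> = (\<Sum>k\<le>n. of_nat k * coeff p k * x ^ (k - 1))"
      by (subst sum.atMost_shift) simp
    finally show ?thesis .
  qed
  then show ?thesis
    by (simp add: sum_poly_shift[OF assms] * ac_simps)
qed

text \<open>
  With \<open>B\<close> the Bezout matrix of \<open>p\<close> and \<open>p'\<close> and \<open>V\<close> the Vandermonde matrix of the roots,
  \<open>V B V\<^sup>T\<close> is diagonal with entries \<open>p'(x k)\<^sup>2\<close>. Hence \<open>|det B|\<close>, which is a nonzero
  integer, equals the right-hand side of the bound.
\<close>

lemma discriminant_ge_1:
  fixes x :: "nat \<Rightarrow> complex"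
  assumes p: "p = Polynomial.smult a (\<Prod>k<n. [:- x k, 1:])" and a: "a \<noteq> 0"
    and inj: "inj_on x {..<n}" and coeffs: "\<And>i. coeff p i \<in> \<int>"
  shows "1 \<le> cmod a ^ (2 * n) * (\<Prod>j<n. \<Prod>k\<in>{..<n} - {j}. cmod (x j - x k))"
proof -
  define q where "q = pderiv p"
  define row_poly where
    "row_poly r = poly_shift (Suc r) p * q - p * poly_shift (Suc r) q" for r
  define V where "V = Matrix.mat n n (\<lambda>(k, i). x k ^ i)"
  define B where "B = Matrix.mat n n (\<lambda>(r, s). coeff (row_poly r) s)"
  have degp: "degree p \<le> n"
    unfolding p by (subst degree_smult_eq) (auto simp: degree_prod_eq_sum_degree)
  have degq: "degree q \<le> n"
    unfolding q_def using degp by (auto intro!: degree_le simp: coeff_pderiv coeff_eq_0)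
  have root: "poly p (x k) = 0" if "k < n" for k
    using that by (auto simp: p poly_prod)
  have q_root: "poly q (x k) = a * (\<Prod>j\<in>{..<n} - {k}. x k - x j)" if "k < n" for k
    using that unfolding q_def p by (simp add: pderiv_smult pderiv_prod_linear_factor_at_root)
  have carr: "V \<in> carrier_mat n n" "B \<in> carrier_mat n n" "transpose_mat V \<in> carrier_mat n n"
    by (auto simp: V_def B_def)
  have q_Ints: "coeff q i \<in> \<int>" for i
    unfolding q_def coeff_pderiv using coeffs by (intro Ints_mult) auto
  have "Determinant.det B \<in> \<int>"
  proof (rule det_Ints[OF carr(2)])
    fix i j assume "i < n" "j < n"
    then show "B $$ (i, j) \<in> \<int>"
      unfolding B_def row_poly_def
      by (auto simp: coeff_mult coeff_poly_shift intro!: Ints_diff Ints_sum Ints_mult coeffs q_Ints)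
  qed
  \<comment> \<open>At a root of \<open>p\<close> the second half of \<open>row_poly r\<close>
    vanishes. The first half supplies one factor \<open>poly q (x l)\<close>; the other factor of
    the square in \<open>VBV\<close> is the difference quotient on the diagonal.\<close>
  have BV: "(B * transpose_mat V) $$ (r, l) = poly (poly_shift (Suc r) p) (x l) * poly q (x l)"
    if "r < n" "l < n" for r l
  proof -
    have deg: "degree (row_poly r) < n"
      unfolding row_poly_def using degp degq that by (intro degree_bezout_row)
    have "(B * transpose_mat V) $$ (r, l) = (\<Sum>s<n. coeff (row_poly r) s * x l ^ s)"
      using that by (simp add: V_def B_def scalar_prod_def atLeast0LessThan)
    also have "\<dots> = (\<Sum>s\<le>degree (row_poly r). coeff (row_poly r) s * x l ^ s)"
      using deg by (intro sum.mono_neutral_right) (auto simp: coeff_eq_0)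
    also have "\<dots> = poly (row_poly r) (x l)"
      by (simp add: poly_altdef)
    finally show ?thesis
      using that by (simp add: row_poly_def root)
  qed
  have VBV: "(V * (B * transpose_mat V)) $$ (k, l) = (if k = l then (poly q (x k))\<^sup>2 else 0)"
    if "k < n" "l < n" for k l
  proof -
    have "(V * (B * transpose_mat V)) $$ (k, l) =
        (\<Sum>r<n. x k ^ r * (B * transpose_mat V) $$ (r, l))"
      using that carr by (simp add: V_def scalar_prod_def atLeast0LessThan)
    also have "\<dots> = (\<Sum>r<n. x k ^ r * poly (poly_shift (Suc r) p) (x l)) * poly q (x l)"
      using that by (simp add: BV sum_distrib_right mult.assoc)
    also have "\<dots> = (if k = l then (poly q (x k))\<^sup>2 else 0)"
    proof (cases "k = l")
      case True
      then show ?thesis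
        using sum_poly_shift_diagonal[OF degp, of "x l"] by (simp add: q_def power2_eq_square)
    next
      case False
      then have "x k - x l \<noteq> 0" using inj that by (auto dest: inj_onD)
      then show ?thesis
        using sum_poly_shift_off_diagonal[OF degp, of "x k" "x l"] that False by (simp add: root)
    qed
    finally show ?thesis .
  qed
  have "Determinant.det (V * (B * transpose_mat V)) = prod_list (diag_mat (V * (B * transpose_mat V)))"
    by (rule det_lower_triangular[where n = n]) (use carr VBV in auto)
  also have "\<dots> = (\<Prod>k<n. (poly q (x k))\<^sup>2)"
    using carr VBV by (simp add: prod_list_diag_prod atLeast0LessThan del: index_mult_mat(1))
  finally have "Determinant.det V * Determinant.det B * Determinant.det V = (\<Prod>k<n. (poly q (x k))\<^sup>2)"
    using carr by (simp add: Determinant.det_mult[where n = n] Determinant.det_transpose[where n = n] mult.assoc)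
  then have "cmod (Determinant.det V * Determinant.det B * Determinant.det V) =
      cmod (\<Prod>k<n. (poly q (x k))\<^sup>2)" by (rule arg_cong)
  then have norm_eq: "cmod (Determinant.det V) * cmod (Determinant.det B) * cmod (Determinant.det V) =
      (\<Prod>k<n. (cmod (poly q (x k)))\<^sup>2)"
    by (simp add: norm_mult norm_power flip: prod_norm)
  define D where "D = (\<Prod>j<n. \<Prod>k\<in>{..<n} - {j}. cmod (x j - x k))"
  have detV: "cmod (Determinant.det V) * cmod (Determinant.det V) = D"
    unfolding D_def V_def det_vandermonde
    by (subst prod_symmetric_off_diagonal) (simp_all add: norm_minus_commute flip: prod_norm)
  have D_pos: "D > 0"
    unfolding D_def using inj by (auto intro!: prod_pos dest: inj_onD)
  have "(\<Prod>k<n. (cmod (poly q (x k)))\<^sup>2) = (\<Prod>k<n. cmod a * (\<Prod>j\<in>{..<n} - {k}. cmod (x k - x j)))\<^sup>2"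
    by (simp add: q_root norm_mult prod_power_distrib flip: prod_norm)
  also have "\<dots> = cmod a ^ (2 * n) * D * D"
  proof -
    have "cmod a ^ (2 * n) = cmod a ^ n * cmod a ^ n" by (simp add: mult_2 power_add)
    then show ?thesis by (simp add: prod.distrib D_def power2_eq_square)
  qed
  finally have "cmod (Determinant.det B) * D = cmod a ^ (2 * n) * D * D"
    using norm_eq detV by (simp add: ac_simps)
  \<comment> \<open>Up to sign \<open>det B\<close> is \<open>a^2\<close> times the discriminant,
    whence the exponent \<open>2 * n\<close> rather than \<open>2 * n - 2\<close>. The surplus is of
    lower order once logarithms are divided by \<open>n^2\<close>.\<close>
  then have detB: "cmod (Determinant.det B) = cmod a ^ (2 * n) * D"
    using D_pos by simp
  moreover have "1 \<le> cmod (Determinant.det B)"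
  proof -
    obtain m where m: "Determinant.det B = of_int m"
      using \<open>Determinant.det B \<in> \<int>\<close> by (elim Ints_cases)
    have "Determinant.det B \<noteq> 0" using detB D_pos a by auto
    then have "\<bar>m\<bar> \<ge> 1" using m by auto
    then show ?thesis by (simp add: m)
  qed
  ultimately show ?thesis by (simp add: D_def)
qed

section \<open>Mahler measure and roots\<close>

lemma borel_measurable_cis [measurable]: "cis \<in> borel_measurable borel"
  by (intro borel_measurable_continuous_onI continuous_intros)

text \<open>The default \<open>ln 0 = 0\<close> spoils limits and additivity of \<open>ln\<close> at
  zeros on the circle. Since \<open>cis t = z\<close> has at most countably many solutions, such
  points can be discarded.\<close>

lemma AE_cis_neq: "AE t in lborel. cis t \<noteq> z"
proof (cases "cmod z = 1")
  case True
  then obtain s where s: "z = cis s" by (metis complex_norm_eq_1_exp cis_conv_exp)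
  have "countable (range (\<lambda>k::int. 2 * pi * of_int k + s))" by simp
  then have "AE t in lborel. t \<notin> range (\<lambda>k::int. 2 * pi * of_int k + s)"
    by (intro AE_not_in countable_imp_null_set_lborel)
  then show ?thesis
  proof eventually_elim
    case (elim t)
    show ?case
    proof
      assume "cis t = z"
      then have "cis (t - s) = 1" by (simp add: s flip: cis_divide)
      then have "cos (t - s) = 1" by (metis cis.sel(1) one_complex.sel(1))
      then obtain k :: int where "t - s = of_int k * 2 * pi"
        by (auto simp: cos_one_2pi_int)
      then have "t = 2 * pi * of_int k + s" by (simp add: algebra_simps)
      with elim show False by blast
    qed
  qed
qed auto

text \<open>Mean value property of the holomorphic function \<open>Ln (1 - b z)\<close>, which is 0
  at the centre. As \<open>|b| < 1\<close>, the argument stays in the open right half-plane on the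
  closed disc, away from the branch cut.\<close>

lemma integral_ln_norm_minus_inside:
  fixes b :: complex
  assumes "cmod b < 1"
  shows "((\<lambda>t. ln (cmod (1 - b * cis t))) has_integral 0) {0..2*pi}"
proof -
  define f where "f z = Ln (1 - b * z)" for z
  have pos: "0 < Re (1 - b * z)" if "cmod z \<le> 1" for z
  proof -
    have "Re (b * z) \<le> cmod (b * z)" by (rule complex_Re_le_cmod)
    also have "\<dots> \<le> cmod b" using that by (simp add: norm_mult mult_left_le)
    finally show ?thesis using assms by simp
  qed
  have nonpos: "1 - b * z \<notin> \<real>\<^sub>\<le>\<^sub>0" if "cmod z \<le> 1" for z
    using pos[OF that] by (auto simp: complex_nonpos_Reals_iff)
  have "f holomorphic_on cball 0 1"
    unfolding f_def using nonpos by (intro holomorphic_intros) auto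
  then have "continuous_on (cball 0 1) f" "f holomorphic_on ball 0 1"
    by (auto intro: holomorphic_on_imp_continuous_on holomorphic_on_subset)
  then have "((\<lambda>u. f u / (u - 0)) has_contour_integral (2 * of_real pi * \<i> * f 0)) (circlepath 0 1)"
    by (rule Cauchy_integral_circlepath) simp
  then have "((\<lambda>u. f u / u) has_contour_integral 0) (part_circlepath 0 1 0 (2*pi))"
    by (simp add: f_def circlepath_def)
  \<comment> \<open>The division by \<open>u\<close> cancels the factor \<open>cis t\<close> in the
    derivative of the path. The remaining \<open>\<i>\<close> moves the real part of
    \<open>f\<close>, which is the logarithm of the modulus, into the imaginary part.\<close>
  then have "((\<lambda>t. f (cis t) * \<i>) has_integral 0) {0..2*pi}"
    by (subst (asm) has_contour_integral_part_circlepath_iff) (auto simp: mult.assoc)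
  then have "((\<lambda>t. Im (f (cis t) * \<i>)) has_integral Im 0) {0..2*pi}"
    by (rule has_integral_Im)
  moreover have "Im (f (cis t) * \<i>) = ln (cmod (1 - b * cis t))" for t
  proof -
    have "1 - b * cis t \<noteq> 0" using pos[of "cis t"] by (metis norm_cis order_refl less_irrefl zero_complex.sel(1))
    then show ?thesis by (simp add: f_def)
  qed
  ultimately show ?thesis by simp
qed

lemma set_integral_ln_norm_minus_inside:
  fixes b :: complex
  assumes "cmod b < 1"
  shows "set_integrable lborel {0..2*pi} (\<lambda>t. ln (cmod (1 - b * cis t)))"
    and "(LBINT t:{0..2*pi}. ln (cmod (1 - b * cis t))) = 0"
proof -
  have nz: "b * cis t \<noteq> 1" for t
  proof
    assume "b * cis t = 1"
    then have "cmod (b * cis t) = 1" by simp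
    then show False using assms by (simp add: norm_mult)
  qed
  show *: "set_integrable lborel {0..2*pi} (\<lambda>t. ln (cmod (1 - b * cis t)))"
    unfolding set_integrable_def
    by (rule borel_integrable_compact) (auto intro!: continuous_intros simp: nz)
  show "(LBINT t:{0..2*pi}. ln (cmod (1 - b * cis t))) = 0"
    using integral_ln_norm_minus_inside[OF assms] set_borel_integral_eq_integral(2)[OF *]
    by (simp add: integral_unique)
qed

text \<open>
  On the unit circle Fatou's lemma, applied to the nonnegative functions
  \<open>ln 2 - ln |1 - r b z|\<close> as \<open>r\<close> tends to 1, gives both integrability and the
  inequality that matters.
\<close>

lemma set_integral_ln_norm_minus_circle:
  fixes b :: complex
  assumes b: "cmod b = 1"
  shows "set_integrable lborel {0..2*pi} (\<lambda>t. ln (cmod (1 - b * cis t)))"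
    and "0 \<le> (LBINT t:{0..2*pi}. ln (cmod (1 - b * cis t)))"
proof -
  define r where "r m = 1 - 1 / (real m + 2)" for m :: nat
  have r: "0 < r m" "r m < 1" for m by (auto simp: r_def field_simps)
  have r_lim: "r \<longlonglongrightarrow> 1"
    unfolding r_def by real_asymp
  define g where "g m t = indicator {0..2*pi} t * (ln 2 - ln (cmod (1 - of_real (r m) * b * cis t)))" for m t
  define g' where "g' t = indicator {0..2*pi} t * (ln 2 - ln (cmod (1 - b * cis t)))" for t
  have le2: "cmod (1 - c * cis t) \<le> 2" if "cmod c \<le> 1" for c t
  proof -
    have "cmod (1 - c * cis t) \<le> cmod 1 + cmod (c * cis t)" by (rule norm_triangle_ineq4)
    then show ?thesis using that by (simp add: norm_mult)
  qed
  \<comment> \<open>This includes the zero of \<open>1 - c * cis t\<close>, where the default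
    \<open>ln 0 = 0\<close> is harmless for an upper bound.\<close>
  have ln_le: "ln (cmod (1 - c * cis t)) \<le> ln 2" if "cmod c \<le> 1" for c t
    using le2[OF that, of t] by (cases "1 - c * cis t = 0") auto
  have cr: "cmod (of_real (r m) * b) < 1" for m using r[of m] b by (simp add: norm_mult)
  have int_g: "integrable lborel (g m)" "(LBINT t. g m t) = 2 * pi * ln 2" for m
  proof -
    have c: "set_integrable lborel {0..2*pi} (\<lambda>t. ln 2 :: real)"
      unfolding set_integrable_def by (rule borel_integrable_compact) auto
    note s = set_integral_diff[OF c set_integral_ln_norm_minus_inside(1)[OF cr[of m]]]
    show "integrable lborel (g m)" using s(1) unfolding set_integrable_def g_def by simp
    have "(LBINT t:{0..2*pi}. ln 2 :: real) = 2 * pi * ln 2"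
      by (simp add: set_lebesgue_integral_def)
    then show "(LBINT t. g m t) = 2 * pi * ln 2"
      using s(2) set_integral_ln_norm_minus_inside(2)[OF cr[of m]]
      unfolding set_lebesgue_integral_def g_def by simp
  qed
  have g_nonneg: "0 \<le> g m t" for m t
    unfolding g_def using ln_le[OF less_imp_le[OF cr[of m]], of t] by (auto simp: indicator_def)
  have g'_nonneg: "0 \<le> g' t" for t
    unfolding g'_def using ln_le[of b t] b by (auto simp: indicator_def)
  have meas: "g' \<in> borel_measurable lborel"
    unfolding g'_def by measurable
  have lim: "(\<lambda>m. g m t) \<longlonglongrightarrow> g' t" if "1 - b * cis t \<noteq> 0" for t
  proof -
    have "(\<lambda>m. indicator {0..2*pi} t * (ln 2 - ln (cmod (1 - of_real (r m) * b * cis t))))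
        \<longlonglongrightarrow> indicator {0..2*pi} t * (ln 2 - ln (cmod (1 - of_real 1 * b * cis t)))"
      using that by (intro tendsto_intros r_lim) auto
    then show ?thesis by (simp add: g_def g'_def)
  qed
  \<comment> \<open>At the zero of the limit function the logarithms tend to minus infinity instead
    of the default value 0, so pointwise convergence holds only almost everywhere.\<close>
  have ae: "AE t in lborel. 1 - b * cis t \<noteq> 0"
    using AE_cis_neq[of "1 / b"]
  proof eventually_elim
    case (elim t)
    moreover have "b \<noteq> 0" using b by auto
    ultimately show ?case by (auto simp: eq_divide_eq mult.commute)
  qed
  have "AE t in lborel. ennreal (g' t) = liminf (\<lambda>m. ennreal (g m t))"
    using ae
  proof eventually_elim
    case (elim t)
    have "(\<lambda>m. ennreal (g m t)) \<longlonglongrightarrow> ennreal (g' t)"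
      using lim[OF elim] by (rule tendsto_ennrealI)
    then show ?case by (simp add: lim_imp_Liminf)
  qed
  then have "(\<integral>\<^sup>+t. ennreal (g' t) \<partial>lborel) = (\<integral>\<^sup>+t. liminf (\<lambda>m. ennreal (g m t)) \<partial>lborel)"
    by (rule nn_integral_cong_AE)
  also have "\<dots> \<le> liminf (\<lambda>m. \<integral>\<^sup>+t. ennreal (g m t) \<partial>lborel)"
    using int_g(1) by (intro nn_integral_liminf) auto
  also have "\<dots> = ennreal (2 * pi * ln 2)"
    using int_g g_nonneg by (simp add: nn_integral_eq_integral Liminf_const)
  finally have fatou: "(\<integral>\<^sup>+t. ennreal (g' t) \<partial>lborel) \<le> ennreal (2 * pi * ln 2)" .
  have int_g': "integrable lborel g'"
    using meas fatou g'_nonneg by (intro integrableI_nonneg) (auto intro: le_less_trans)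
  then have le: "(LBINT t. g' t) \<le> 2 * pi * ln 2"
    using fatou g'_nonneg by (simp add: nn_integral_eq_integral)
  have c: "set_integrable lborel {0..2*pi} (\<lambda>t. ln 2 :: real)"
    unfolding set_integrable_def by (rule borel_integrable_compact) auto
  have i: "set_integrable lborel {0..2*pi} (\<lambda>t. ln 2 - ln (cmod (1 - b * cis t)))"
    using int_g' unfolding set_integrable_def g'_def by simp
  note s = set_integral_diff[OF c i]
  show "set_integrable lborel {0..2*pi} (\<lambda>t. ln (cmod (1 - b * cis t)))"
    using s(1) by simp
  have "(LBINT t:{0..2*pi}. ln 2 :: real) = 2 * pi * ln 2"
    by (simp add: set_lebesgue_integral_def)
  then show "0 \<le> (LBINT t:{0..2*pi}. ln (cmod (1 - b * cis t)))"
    using s(2) le unfolding set_lebesgue_integral_def g'_def by simp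
qed

text \<open>Equality holds by Jensen's formula; only this direction is used.\<close>

lemma set_integral_ln_norm_minus_ge:
  fixes \<alpha> :: complex
  shows "set_integrable lborel {0..2*pi} (\<lambda>t. ln (cmod (cis t - \<alpha>)))"
    and "2 * pi * ln (max 1 (cmod \<alpha>)) \<le> (LBINT t:{0..2*pi}. ln (cmod (cis t - \<alpha>)))"
proof -
  have "set_integrable lborel {0..2*pi} (\<lambda>t. ln (cmod (cis t - \<alpha>))) \<and>
    2 * pi * ln (max 1 (cmod \<alpha>)) \<le> (LBINT t:{0..2*pi}. ln (cmod (cis t - \<alpha>)))"
  proof (cases "cmod \<alpha> \<le> 1")
    case True
    \<comment> \<open>Conjugation and a factor of modulus 1 replace \<open>cis t - \<alpha>\<close>
      by \<open>1 - cnj \<alpha> * cis t\<close>; there is no division by \<open>\<alpha>\<close>,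
      which may be 0 here.\<close>
    define b where "b = cnj \<alpha>"
    have b: "cmod b \<le> 1" using True by (simp add: b_def)
    have "cmod (cis t - \<alpha>) = cmod (1 - b * cis t)" for t
    proof -
      have "cmod (cis t - \<alpha>) = cmod (cnj (cis t - \<alpha>))" by (rule complex_mod_cnj[symmetric])
      also have "cnj (cis t - \<alpha>) = cis (- t) * (1 - b * cis t)"
        by (simp add: b_def algebra_simps cis_cnj cis_mult)
      finally show ?thesis by (simp add: norm_mult)
    qed
    moreover have "set_integrable lborel {0..2*pi} (\<lambda>t. ln (cmod (1 - b * cis t)))"
      "0 \<le> (LBINT t:{0..2*pi}. ln (cmod (1 - b * cis t)))"
      using set_integral_ln_norm_minus_inside[of b] set_integral_ln_norm_minus_circle[of b] b
      by (cases "cmod b = 1"; force)+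
    ultimately show ?thesis using True by (simp add: max_def)
  next
    case False
    then have nz: "\<alpha> \<noteq> 0" by auto
    define b where "b = 1 / \<alpha>"
    have b: "cmod b < 1" using False nz by (simp add: b_def norm_divide divide_less_eq_1)
    have eq: "ln (cmod (cis t - \<alpha>)) = ln (cmod \<alpha>) + ln (cmod (1 - b * cis t))" for t
    proof -
      have "cmod (b * cis t) < 1" using b by (simp add: norm_mult)
      then have "1 - b * cis t \<noteq> 0" by (metis eq_iff_diff_eq_0 norm_one less_irrefl)
      moreover have "cmod (cis t - \<alpha>) = cmod \<alpha> * cmod (1 - b * cis t)"
        using nz by (subst norm_minus_commute) (simp add: b_def algebra_simps flip: norm_mult)
      ultimately show ?thesis using nz by (simp add: ln_mult)
    qed
    have c: "set_integrable lborel {0..2*pi} (\<lambda>t. ln (cmod \<alpha>))"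
      unfolding set_integrable_def by (rule borel_integrable_compact) auto
    have "(LBINT t:{0..2*pi}. ln (cmod \<alpha>)) = 2 * pi * ln (cmod \<alpha>)"
      by (simp add: set_lebesgue_integral_def)
    then show ?thesis
      using set_integral_add[OF c set_integral_ln_norm_minus_inside(1)[OF b]]
        set_integral_ln_norm_minus_inside(2)[OF b] False
      by (simp add: eq)
  qed
  then show "set_integrable lborel {0..2*pi} (\<lambda>t. ln (cmod (cis t - \<alpha>)))"
    and "2 * pi * ln (max 1 (cmod \<alpha>)) \<le> (LBINT t:{0..2*pi}. ln (cmod (cis t - \<alpha>)))"
    by blast+
qed

text \<open>Off the null set of \<open>t\<close> for which \<open>cis t\<close> is a zero of
  \<open>p\<close>, the logarithm of \<open>|p|\<close> splits into a constant and one term per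
  linear factor, and each factor is estimated separately.\<close>

lemma ln_mahler_measure_ge:
  fixes x :: "nat \<Rightarrow> complex"
  assumes a: "a \<noteq> 0" and p: "p = smult a (\<Prod>k<n. [:- x k, 1:])"
  shows "ln (cmod a) + (\<Sum>k<n. ln (max 1 (cmod (x k)))) \<le> ln (mahler_measure p)"
proof -
  have c: "set_integrable lborel {0..2*pi} (\<lambda>t. ln (cmod a))"
    unfolding set_integrable_def by (rule borel_integrable_compact) auto
  have cI: "(LBINT t:{0..2*pi}. ln (cmod a)) = 2 * pi * ln (cmod a)"
    by (simp add: set_lebesgue_integral_def)
  have s: "set_integrable lborel {0..2*pi} (\<lambda>t. \<Sum>k<n. ln (cmod (cis t - x k)))"
    using set_integral_ln_norm_minus_ge(1) unfolding set_integrable_def scaleR_sum_right by (intro Bochner_Integration.integrable_sum) auto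
  have [measurable]: "poly p \<in> borel_measurable borel"
    by (intro borel_measurable_continuous_onI continuous_intros)
  have "(LBINT t:{0..2*pi}. ln (cmod (poly p (exp (\<i> * of_real t))))) =
        (LBINT t:{0..2*pi}. ln (cmod a) + (\<Sum>k<n. ln (cmod (cis t - x k))))"
  proof (rule set_lebesgue_integral_cong_AE)
    show "AE t\<in>{0..2*pi} in lborel. ln (cmod (poly p (exp (\<i> * of_real t)))) =
        ln (cmod a) + (\<Sum>k<n. ln (cmod (cis t - x k)))"
    proof -
      have "AE t in lborel. \<forall>k\<in>{..<n}. cis t \<noteq> x k"
        using AE_cis_neq by (intro AE_finite_allI) auto
      then show ?thesis
      proof eventually_elim
        case (elim t)
        show ?case
        proof
          have nz': "cis t - x k \<noteq> 0" if "k < n" for k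
            using that elim by auto
          have "cmod (poly p (cis t)) = cmod a * (\<Prod>k<n. cmod (cis t - x k))"
            by (simp add: p poly_prod norm_mult flip: prod_norm)
          moreover have "ln (\<Prod>k<n. cmod (cis t - x k)) = (\<Sum>k<n. ln (cmod (cis t - x k)))"
            using nz' by (intro ln_prod) auto
          ultimately show "ln (cmod (poly p (exp (\<i> * of_real t)))) =
              ln (cmod a) + (\<Sum>k<n. ln (cmod (cis t - x k)))"
            using a nz' by (simp add: cis_conv_exp[symmetric] ln_mult prod_pos)
        qed
      qed
    qed
  qed measurable
  also have "\<dots> = 2 * pi * ln (cmod a) + (\<Sum>k<n. LBINT t:{0..2*pi}. ln (cmod (cis t - x k)))"
  proof -
    have "(LBINT t:{0..2*pi}. \<Sum>k<n. ln (cmod (cis t - x k))) =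
        (\<Sum>k<n. LBINT t:{0..2*pi}. ln (cmod (cis t - x k)))"
      using set_integral_ln_norm_minus_ge(1)
      unfolding set_lebesgue_integral_def set_integrable_def scaleR_sum_right
      by (intro Bochner_Integration.integral_sum) auto
    then show ?thesis by (simp add: set_integral_add(2)[OF c s] cI)
  qed
  also have "\<dots> \<ge> 2 * pi * ln (cmod a) + (\<Sum>k<n. 2 * pi * ln (max 1 (cmod (x k))))"
    by (intro add_left_mono sum_mono set_integral_ln_norm_minus_ge(2))
  finally have "2 * pi * (ln (cmod a) + (\<Sum>k<n. ln (max 1 (cmod (x k))))) \<le>
      (LBINT t:{0..2*pi}. ln (cmod (poly p (exp (\<i> * of_real t)))))"
    by (simp add: sum_distrib_left distrib_left)
  then show ?thesis
    by (simp add: mahler_measure_def field_simps)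
qed

section \<open>Weak* convergence and double integrals\<close>

lemma continuous_imp_borel_measurable:
  assumes "sets M = sets borel" "continuous_on UNIV f"
  shows "f \<in> borel_measurable M"
  unfolding measurable_cong_sets[OF assms(1) refl] using assms(2) by (rule borel_measurable_continuous_onI)

lemma continuous_compact_support_bounded:
  fixes f :: "'a::topological_space \<Rightarrow> real"
  assumes "compact K" "continuous_on K f" and supp: "\<And>x. f x \<noteq> 0 \<Longrightarrow> x \<in> K"
  shows "\<exists>B. \<forall>x. \<bar>f x\<bar> \<le> B"
proof -
  have "compact (f ` K)"
    using assms(2,1) by (rule compact_continuous_image)
  then obtain B where B: "\<And>x. x \<in> K \<Longrightarrow> \<bar>f x\<bar> \<le> B"
    by (metis bounded_iff compact_imp_bounded imageI real_norm_def)
  have "\<bar>f x\<bar> \<le> \<bar>B\<bar>" for x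
    using B[of x] supp[of x] by (cases "f x = 0") auto
  then show ?thesis by blast
qed

lemma nn_integral_double_eq:
  fixes f :: "'a \<Rightarrow> 'b \<Rightarrow> ennreal"
  assumes "sigma_finite_measure N" "(\<lambda>(x, y). f x y) \<in> borel_measurable (M \<Otimes>\<^sub>M N)"
  shows "(\<integral>\<^sup>+x. \<integral>\<^sup>+y. f x y \<partial>N \<partial>M) = (\<integral>\<^sup>+w. (case w of (x, y) \<Rightarrow> f x y) \<partial>(M \<Otimes>\<^sub>M N))"
  using sigma_finite_measure.nn_integral_fst[OF assms] by simp

lemma nn_integral_double_add:
  fixes f g :: "'a \<Rightarrow> 'b \<Rightarrow> ennreal"
  assumes N: "sigma_finite_measure N"
    and f: "(\<lambda>(x, y). f x y) \<in> borel_measurable (M \<Otimes>\<^sub>M N)"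
    and g: "(\<lambda>(x, y). g x y) \<in> borel_measurable (M \<Otimes>\<^sub>M N)"
  shows "(\<integral>\<^sup>+x. \<integral>\<^sup>+y. f x y + g x y \<partial>N \<partial>M) =
    (\<integral>\<^sup>+x. \<integral>\<^sup>+y. f x y \<partial>N \<partial>M) + (\<integral>\<^sup>+x. \<integral>\<^sup>+y. g x y \<partial>N \<partial>M)"
proof -
  have fg: "(\<lambda>(x, y). f x y + g x y) \<in> borel_measurable (M \<Otimes>\<^sub>M N)"
    using borel_measurable_add[OF f g] by (simp add: case_prod_unfold)
  have "(\<integral>\<^sup>+x. \<integral>\<^sup>+y. f x y + g x y \<partial>N \<partial>M) =
      (\<integral>\<^sup>+w. (case w of (x, y) \<Rightarrow> f x y + g x y) \<partial>(M \<Otimes>\<^sub>M N))"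
    by (rule nn_integral_double_eq[OF N fg])
  also have "\<dots> = (\<integral>\<^sup>+w. (case w of (x, y) \<Rightarrow> f x y) \<partial>(M \<Otimes>\<^sub>M N)) +
      (\<integral>\<^sup>+w. (case w of (x, y) \<Rightarrow> g x y) \<partial>(M \<Otimes>\<^sub>M N))"
    using nn_integral_add[OF f g] by (simp add: case_prod_unfold)
  finally show ?thesis
    by (simp only: nn_integral_double_eq[OF N f] nn_integral_double_eq[OF N g])
qed

lemma nn_integral_double_monotone_convergence:
  fixes f :: "nat \<Rightarrow> 'a \<Rightarrow> 'b \<Rightarrow> ennreal"
  assumes N: "sigma_finite_measure N"
    and meas: "\<And>i. (\<lambda>(x, y). f i x y) \<in> borel_measurable (M \<Otimes>\<^sub>M N)"
    and mono: "\<And>i x y. f i x y \<le> f (Suc i) x y"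
  shows "(\<integral>\<^sup>+x. \<integral>\<^sup>+y. (SUP i. f i x y) \<partial>N \<partial>M) = (SUP i. \<integral>\<^sup>+x. \<integral>\<^sup>+y. f i x y \<partial>N \<partial>M)"
proof -
  interpret N: sigma_finite_measure N by fact
  have "(\<integral>\<^sup>+x. \<integral>\<^sup>+y. (SUP i. f i x y) \<partial>N \<partial>M) = (\<integral>\<^sup>+x. (SUP i. \<integral>\<^sup>+y. f i x y \<partial>N) \<partial>M)"
  proof (rule nn_integral_cong)
    fix x assume "x \<in> space M"
    then have "f i x \<in> borel_measurable N" for i
      using measurable_Pair2[OF meas[of i], of x] by simp
    then show "(\<integral>\<^sup>+y. (SUP i. f i x y) \<partial>N) = (SUP i. \<integral>\<^sup>+y. f i x y \<partial>N)"
      using mono by (intro nn_integral_monotone_convergence_SUP) (auto intro!: incseq_SucI le_funI)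
  qed
  also have "\<dots> = (SUP i. \<integral>\<^sup>+x. \<integral>\<^sup>+y. f i x y \<partial>N \<partial>M)"
    using mono N.borel_measurable_nn_integral[OF meas]
    by (intro nn_integral_monotone_convergence_SUP)
       (auto intro!: incseq_SucI le_funI nn_integral_mono)
  finally show ?thesis .
qed

lemma (in finite_measure) abs_integral_le:
  fixes f :: "'a \<Rightarrow> real"
  assumes "f \<in> borel_measurable M" and le: "\<And>x. \<bar>f x\<bar> \<le> c"
  shows "\<bar>\<integral>x. f x \<partial>M\<bar> \<le> c * measure M (space M)"
proof -
  have "integrable M f"
    using assms by (intro integrable_const_bound[of _ c]) auto
  then have "\<bar>\<integral>x. f x \<partial>M\<bar> \<le> (\<integral>x. c \<partial>M)"
    using le by (intro order_trans[OF integral_abs_bound] integral_mono) auto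
  then show ?thesis by (simp add: mult.commute)
qed

lemma compact_support_in_cball:
  fixes g :: "complex \<Rightarrow> real"
  assumes "\<And>z. g z \<noteq> 0 \<Longrightarrow> cmod z \<le> R"
  shows "compact (closure {z. g z \<noteq> 0})"
proof -
  have "bounded {z. g z \<noteq> 0}"
    using assms by (auto intro: boundedI)
  then show ?thesis by (simp add: compact_closure)
qed

lemma weak_star_tendstoD:
  fixes g :: "complex \<Rightarrow> real"
  assumes "weak_star_tendsto \<mu> \<tau> F" "continuous_on UNIV g" "\<And>z. g z \<noteq> 0 \<Longrightarrow> cmod z \<le> R"
  shows "((\<lambda>i. \<integral>z. g z \<partial>\<mu> i) \<longlongrightarrow> (\<integral>z. g z \<partial>\<tau>)) F"
  using assms compact_support_in_cball[of g R] unfolding weak_star_tendsto_def by blast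

text \<open>
  The inner integrals converge pointwise and are equicontinuous in the outer variable,
  hence they converge uniformly.
\<close>

lemma weak_star_tendsto_double_integral:
  fixes f :: "complex \<Rightarrow> complex \<Rightarrow> real"
  assumes conv: "weak_star_tendsto \<mu> \<tau> F"
    and prob: "\<forall>\<^sub>F i in F. prob_space (\<mu> i) \<and> sets (\<mu> i) = sets borel"
    and fin: "finite_measure \<tau>" and sets_\<tau>: "sets \<tau> = sets borel"
    and cont: "continuous_on UNIV (\<lambda>(z, t). f z t)"
    and supp: "\<And>z t. f z t \<noteq> 0 \<Longrightarrow> cmod z \<le> R \<and> cmod t \<le> R"
  shows "((\<lambda>i. \<integral>z. \<integral>t. f z t \<partial>\<mu> i \<partial>\<mu> i) \<longlongrightarrow> (\<integral>z. \<integral>t. f z t \<partial>\<tau> \<partial>\<tau>)) F"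
proof -
  interpret \<tau>: finite_measure \<tau> by fact
  \<comment> \<open>The margin 1 serves pairs \<open>z\<close>, \<open>z'\<close> of distance less
    than 1: if one of them lies in the ball of radius \<open>R\<close>, both lie in the larger ball,
    and uniform continuity on \<open>K\<close> applies.\<close>
  define K where "K = cball (0::complex) (R + 1) \<times> cball (0::complex) (R + 1)"
  have "compact K" unfolding K_def by (intro compact_Times compact_cball)
  have contK: "continuous_on K (\<lambda>(z, t). f z t)"
    using cont by (rule continuous_on_subset) simp
  have cont_snd: "continuous_on UNIV (f z)" for z
  proof -
    have "continuous_on UNIV (\<lambda>t. case (z, t) of (z, t) \<Rightarrow> f z t)"
      by (rule continuous_on_compose2[OF cont]) (intro continuous_on_Pair continuous_on_const continuous_on_id, simp)
    then show ?thesis by simp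
  qed
  have meas: "f z \<in> borel_measurable M" if "sets M = sets borel" for z M
    using that cont_snd by (rule continuous_imp_borel_measurable)
  have unif: "\<exists>d>0. \<forall>z z'. dist z' z < d \<longrightarrow> (\<forall>t. \<bar>f z' t - f z t\<bar> \<le> e)" if "e > 0" for e
  proof -
    have "uniformly_continuous_on K (\<lambda>(z, t). f z t)"
      using contK \<open>compact K\<close> by (rule compact_uniformly_continuous)
    then obtain d where d: "d > 0"
      "\<And>w w'. w \<in> K \<Longrightarrow> w' \<in> K \<Longrightarrow> dist w' w < d \<Longrightarrow> dist (case w' of (z, t) \<Rightarrow> f z t) (case w of (z, t) \<Rightarrow> f z t) < e"
      using \<open>e > 0\<close> by (rule uniformly_continuous_onE) blast
    have "\<bar>f z' t - f z t\<bar> \<le> e" if close: "dist z' z < min d 1" for z z' t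
    proof (cases "f z t = 0 \<and> f z' t = 0")
      case False
      then have "cmod t \<le> R" and "cmod z \<le> R \<or> cmod z' \<le> R" using supp by blast+
      moreover have "cmod z \<le> cmod z' + 1" "cmod z' \<le> cmod z + 1"
        using close norm_triangle_ineq2[of z z'] norm_triangle_ineq2[of z' z]
        by (auto simp: dist_norm norm_minus_commute)
      ultimately have "(z, t) \<in> K" "(z', t) \<in> K" by (auto simp: K_def)
      moreover have "dist (z', t) (z, t) < d" using close by (simp add: dist_Pair_Pair)
      ultimately show ?thesis using d(2)[of "(z, t)" "(z', t)"] by (simp add: dist_real_def)
    qed (use \<open>e > 0\<close> in simp)
    then show ?thesis using d(1) by (intro exI[of _ "min d 1"]) auto
  qed
  have suppK: "w \<in> K" if "(case w of (z, t) \<Rightarrow> f z t) \<noteq> 0" for w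
    using supp[of "fst w" "snd w"] that by (cases w) (auto simp: K_def)
  obtain B where "\<forall>w. \<bar>case w of (z, t) \<Rightarrow> f z t\<bar> \<le> B"
    using continuous_compact_support_bounded[OF \<open>compact K\<close> contK suppK] by blast
  then have B: "\<bar>f z t\<bar> \<le> B" for z t by auto
  define G where "G M z = (\<integral>t. f z t \<partial>M)" for M z
  have G_diff: "\<bar>G M z' - G M z\<bar> \<le> e * measure M (space M)"
    if "finite_measure M" "sets M = sets borel" "\<And>t. \<bar>f z' t - f z t\<bar> \<le> e" for M z z' e
  proof -
    interpret M: finite_measure M by fact
    have int: "integrable M (f w)" for w
      using meas[OF that(2)] B by (intro M.integrable_const_bound[of _ B]) auto
    have "G M z' - G M z = (\<integral>t. f z' t - f z t \<partial>M)"
      unfolding G_def using int by (simp add: Bochner_Integration.integral_diff)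
    moreover have "(\<lambda>t. f z' t - f z t) \<in> borel_measurable M"
      using meas[OF that(2)] by (intro borel_measurable_diff)
    ultimately show ?thesis
      using M.abs_integral_le[of "\<lambda>t. f z' t - f z t" e] that(3) by simp
  qed
  define m where "m = measure \<tau> (space \<tau>)"
  have m0: "m \<ge> 0" by (simp add: m_def)
  have contG: "continuous_on UNIV (G M)" if M: "finite_measure M" "sets M = sets borel" for M
    unfolding continuous_on_iff
  proof safe
    fix z :: complex and e :: real assume "e > 0"
    define c where "c = e / (measure M (space M) + 1)"
    have M0: "measure M (space M) \<ge> 0" by simp
    have "c > 0" using \<open>e > 0\<close> M0 unfolding c_def by (intro divide_pos_pos) linarith+
    from unif[OF this] obtain d where d: "d > 0"
      "\<forall>z z'. dist z' z < d \<longrightarrow> (\<forall>t. \<bar>f z' t - f z t\<bar> \<le> c)"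
      by - (elim exE conjE, rule that, assumption+)
    have "c * (measure M (space M) + 1) = e" using M0 by (simp add: c_def add_nonneg_eq_0_iff)
    then have "c * measure M (space M) < e" using \<open>c > 0\<close> by (simp add: algebra_simps)
    then have "dist (G M z') (G M z) < e" if "dist z' z < d" for z'
      using G_diff[OF M, of z' z c] d(2) that by (simp add: dist_real_def)
    then show "\<exists>d>0. \<forall>z'\<in>UNIV. dist z' z < d \<longrightarrow> dist (G M z') (G M z) < e"
      using d(1) by blast
  qed
  have G0: "G M z = 0" if "\<not> cmod z \<le> R" for M z
  proof -
    have "f z t = 0" for t using supp[of z t] that by blast
    then show ?thesis by (simp add: G_def)
  qed
  have ptwise: "((\<lambda>i. G (\<mu> i) z) \<longlongrightarrow> G \<tau> z) F" for z
    unfolding G_def using supp by (intro weak_star_tendstoD[OF conv cont_snd, of _ R]) blast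
  have outer: "((\<lambda>i. \<integral>z. G \<tau> z \<partial>\<mu> i) \<longlongrightarrow> (\<integral>z. G \<tau> z \<partial>\<tau>)) F"
    using G0 by (intro weak_star_tendstoD[OF conv contG[OF fin sets_\<tau>], of R]) blast
  have "((\<lambda>i. \<integral>z. G (\<mu> i) z \<partial>\<mu> i) \<longlongrightarrow> (\<integral>z. G \<tau> z \<partial>\<tau>)) F"
  proof (rule tendstoI)
    fix \<epsilon> :: real assume "\<epsilon> > 0"
    \<comment> \<open>Error budget: moving from \<open>z\<close> to a net point costs
      \<open>e\<close> under \<open>\<mu> i\<close> and \<open>e * m\<close> under
      \<open>\<tau>\<close>, convergence at the net points costs \<open>e\<close>, and the outer
      integral costs another \<open>e\<close>. The total \<open>e * (m + 3)\<close> stays strictly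
      below \<open>\<epsilon>\<close>.\<close>
    define e where "e = \<epsilon> / (m + 4)"
    have e: "e > 0" "e * (m + 3) < \<epsilon>"
      using \<open>\<epsilon> > 0\<close> m0 by (auto simp: e_def field_simps)
    from unif[OF e(1)] obtain d where d: "d > 0"
      "\<forall>z z'. dist z' z < d \<longrightarrow> (\<forall>t. \<bar>f z' t - f z t\<bar> \<le> e)"
      by - (elim exE conjE, rule that, assumption+)
    have "\<exists>Z. finite Z \<and> cball (0::complex) R \<subseteq> (\<Union>z\<in>Z. ball z d)"
      by (rule compact_eq_totally_bounded[THEN iffD1, OF compact_cball, THEN conjunct2, rule_format, OF d(1)])
    then obtain Z where Z: "finite Z" "cball (0::complex) R \<subseteq> (\<Union>z\<in>Z. ball z d)" by blast
    have "\<forall>\<^sub>F i in F. \<forall>z\<in>Z. dist (G (\<mu> i) z) (G \<tau> z) < e"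
      by (rule eventually_ball_finite[OF Z(1)], rule ballI, rule tendstoD[OF ptwise e(1)])
    moreover have "\<forall>\<^sub>F i in F. dist (\<integral>z. G \<tau> z \<partial>\<mu> i) (\<integral>z. G \<tau> z \<partial>\<tau>) < e"
      using outer e(1) by (rule tendstoD)
    ultimately show "\<forall>\<^sub>F i in F. dist (\<integral>z. G (\<mu> i) z \<partial>\<mu> i) (\<integral>z. G \<tau> z \<partial>\<tau>) < \<epsilon>"
      using prob
    proof eventually_elim
      case (elim i)
      then interpret \<mu>: prob_space "\<mu> i" by simp
      have sets_i: "sets (\<mu> i) = sets borel" using elim by simp
      have unif_G: "\<bar>G (\<mu> i) z - G \<tau> z\<bar> \<le> e * (m + 2)" for z
      proof (cases "cmod z \<le> R")
        case True
        then obtain w where w: "w \<in> Z" "dist w z < d" using Z(2) by auto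
        have "\<bar>f w t - f z t\<bar> \<le> e" for t using d(2) w(2) by simp
        then have "\<bar>G (\<mu> i) w - G (\<mu> i) z\<bar> \<le> e" "\<bar>G \<tau> w - G \<tau> z\<bar> \<le> e * m"
          using G_diff[OF \<mu>.finite_measure_axioms sets_i, of w z e]
            G_diff[OF fin sets_\<tau>, of w z e]
          by (auto simp: \<mu>.prob_space m_def)
        moreover have "\<bar>G (\<mu> i) w - G \<tau> w\<bar> < e" using elim w(1) by (simp add: dist_real_def)
        ultimately show ?thesis by (simp add: algebra_simps)
      qed (use G0 e m0 in simp)
      have bdd: "\<bar>G M z\<bar> \<le> B * measure M (space M)" if "finite_measure M" "sets M = sets borel" for M z
        unfolding G_def using finite_measure.abs_integral_le[OF that(1) meas[OF that(2)] B] .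
      have G_meas: "G M \<in> borel_measurable (\<mu> i)" if "finite_measure M" "sets M = sets borel" for M
        using sets_i contG[OF that] by (rule continuous_imp_borel_measurable)
      have int: "integrable (\<mu> i) (G M)" if "finite_measure M" "sets M = sets borel" for M
        using bdd[OF that] G_meas[OF that] by (intro \<mu>.integrable_const_bound) auto
      note ints = int[OF \<mu>.finite_measure_axioms sets_i] int[OF fin sets_\<tau>]
      have "\<bar>\<integral>z. G (\<mu> i) z - G \<tau> z \<partial>\<mu> i\<bar> \<le> e * (m + 2) * measure (\<mu> i) (space (\<mu> i))"
        using unif_G ints by (intro \<mu>.abs_integral_le) auto
      then have "\<bar>(\<integral>z. G (\<mu> i) z \<partial>\<mu> i) - (\<integral>z. G \<tau> z \<partial>\<mu> i)\<bar> \<le> e * (m + 2)"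
        using ints by (simp add: \<mu>.prob_space)
      moreover have "\<bar>(\<integral>z. G \<tau> z \<partial>\<mu> i) - (\<integral>z. G \<tau> z \<partial>\<tau>)\<bar> < e"
        using elim by (simp add: dist_real_def)
      ultimately have "\<bar>(\<integral>z. G (\<mu> i) z \<partial>\<mu> i) - (\<integral>z. G \<tau> z \<partial>\<tau>)\<bar> < e * (m + 3)"
        by (simp add: algebra_simps)
      then show ?case using e(2) by (simp add: dist_real_def)
    qed
  qed
  then show ?thesis by (simp add: G_def)
qed

section \<open>Cutoffs and nonnegative integrands of unbounded support\<close>

definition cutoff :: "real \<Rightarrow> complex \<Rightarrow> real" where
  "cutoff R z = max 0 (min 1 (R + 1 - cmod z))"

lemma cutoff_bounds: "0 \<le> cutoff R z" "cutoff R z \<le> 1"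
  by (auto simp: cutoff_def)

lemma cutoff_mono: "R \<le> R' \<Longrightarrow> cutoff R z \<le> cutoff R' z"
  by (auto simp: cutoff_def)

lemma cutoff_eq_1: "cmod z \<le> R \<Longrightarrow> cutoff R z = 1"
  by (auto simp: cutoff_def)

lemma cutoff_nonzero: "cutoff R z \<noteq> 0 \<Longrightarrow> cmod z \<le> R + 1"
  by (auto simp: cutoff_def split: if_splits)

lemma continuous_on_cutoff [continuous_intros]:
  "continuous_on S g \<Longrightarrow> continuous_on S (\<lambda>x. cutoff R (g x))"
  unfolding cutoff_def by (intro continuous_intros)

lemma SUP_times_cutoff:
  assumes "c \<ge> 0"
  shows "(SUP m. ennreal (c * cutoff (real m) z)) = ennreal c"
proof (rule antisym)
  show "(SUP m. ennreal (c * cutoff (real m) z)) \<le> ennreal c"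
    using assms cutoff_bounds by (intro SUP_least ennreal_leI) (simp add: mult_left_le)
  obtain m :: nat where "cmod z \<le> real m" using real_arch_simple by blast
  then have "ennreal c = ennreal (c * cutoff (real m) z)" by (simp add: cutoff_eq_1)
  then show "ennreal c \<le> (SUP m. ennreal (c * cutoff (real m) z))"
    by (metis SUP_upper UNIV_I)
qed

text \<open>A Fatou-type inequality: \<open>h\<close> times a cutoff is a test function and lies
  below \<open>h\<close>, so the bound passes to the limit for every cutoff, and monotone
  convergence removes the cutoff. Mass may escape, hence only an inequality. It serves for
  \<open>h = 1\<close> and for \<open>log_plus\<close>.\<close>

lemma weak_star_nn_integral_le:
  fixes h :: "complex \<Rightarrow> real"
  assumes conv: "weak_star_tendsto \<mu> \<tau> F" and F: "F \<noteq> bot"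
    and sets_\<tau>: "sets \<tau> = sets borel" and loc: "\<And>K. compact K \<Longrightarrow> emeasure \<tau> K < \<infinity>"
    and cont: "continuous_on UNIV h" and nonneg: "\<And>z. 0 \<le> h z"
    and bound: "\<forall>\<^sub>F i in F. integrable (\<mu> i) h \<and> (\<integral>z. h z \<partial>\<mu> i) \<le> c"
  shows "(\<integral>\<^sup>+z. ennreal (h z) \<partial>\<tau>) \<le> ennreal c"
proof -
  define h' where "h' m z = h z * cutoff (real m) z" for m :: nat and z
  have conth': "continuous_on UNIV (h' m)" for m
    unfolding h'_def by (intro continuous_intros cont)
  have meas: "h' m \<in> borel_measurable \<tau>" for m
    using sets_\<tau> conth' by (rule continuous_imp_borel_measurable)
  have h'_nonneg: "0 \<le> h' m z" and h'_le: "h' m z \<le> h z" for m z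
    using nonneg[of z] cutoff_bounds[of "real m" z] by (auto simp: h'_def mult_left_le)
  have h'_supp: "cmod z \<le> real m + 1" if "h' m z \<noteq> 0" for m z
    using that cutoff_nonzero by (auto simp: h'_def)
  \<comment> \<open>Total mass of \<open>\<tau>\<close> is not yet known to be finite; integrability
    comes from the finite mass of a ball containing the support.\<close>
  have int: "integrable \<tau> (h' m)" for m
  proof -
    have "\<exists>B. \<forall>z. \<bar>h' m z\<bar> \<le> B"
      by (rule continuous_compact_support_bounded[of "cball 0 (real m + 1)"])
         (auto intro: continuous_on_subset[OF conth'] dest: h'_supp)
    then obtain B where B: "\<And>z. \<bar>h' m z\<bar> \<le> B" by blast
    show ?thesis
    proof (rule integrableI_bounded_set)
      show "cball 0 (real m + 1) \<in> sets \<tau>" by (simp add: sets_\<tau>)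
      show "h' m \<in> borel_measurable \<tau>" by (rule meas)
      show "emeasure \<tau> (cball 0 (real m + 1)) < \<infinity>" by (rule loc) simp
      show "AE x\<in>cball 0 (real m + 1) in \<tau>. norm (h' m x) \<le> B" using B by auto
      show "AE x in \<tau>. x \<notin> cball 0 (real m + 1) \<longrightarrow> h' m x = 0" using h'_supp[of m] by auto
    qed
  qed
  have le: "(\<integral>z. h' m z \<partial>\<tau>) \<le> c" for m
  proof (rule tendsto_upperbound[OF weak_star_tendstoD[OF conv conth', of m "real m + 1"] _ F])
    show "cmod z \<le> real m + 1" if "h' m z \<noteq> 0" for z using that by (rule h'_supp)
    show "\<forall>\<^sub>F i in F. (\<integral>z. h' m z \<partial>\<mu> i) \<le> c"
      using bound
    proof eventually_elim
      case (elim i)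
      have "(\<integral>z. h' m z \<partial>\<mu> i) \<le> (\<integral>z. h z \<partial>\<mu> i)"
        using elim h'_le nonneg by (intro integral_mono') auto
      then show ?case using elim by linarith
    qed
  qed
  have "(\<integral>\<^sup>+z. ennreal (h z) \<partial>\<tau>) = (\<integral>\<^sup>+z. (SUP m. ennreal (h' m z)) \<partial>\<tau>)"
    unfolding h'_def using nonneg by (simp add: SUP_times_cutoff)
  also have "\<dots> = (SUP m. \<integral>\<^sup>+z. ennreal (h' m z) \<partial>\<tau>)"
  proof (rule nn_integral_monotone_convergence_SUP)
    show "incseq (\<lambda>m z. ennreal (h' m z))"
      using nonneg unfolding h'_def
      by (intro incseq_SucI le_funI ennreal_leI mult_left_mono cutoff_mono) auto
  qed (use meas in measurable)
  also have "\<dots> \<le> ennreal c"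
    using int h'_nonneg le by (intro SUP_least) (simp add: nn_integral_eq_integral ennreal_leI)
  finally show ?thesis .
qed

section \<open>The shifted logarithmic kernel\<close>

definition log_plus :: "complex \<Rightarrow> real" where
  "log_plus z = ln (max 1 (cmod z))"

lemma log_plus_nonneg: "0 \<le> log_plus z"
  by (simp add: log_plus_def)

lemma log_plus_eq: "log_plus z = max 0 (ln (cmod z))"
  by (cases "z = 0") (auto simp: log_plus_def max_def)

lemma continuous_on_log_plus [continuous_intros]:
  "continuous_on S g \<Longrightarrow> continuous_on S (\<lambda>x. log_plus (g x))"
  unfolding log_plus_def by (intro continuous_intros ballI less_imp_neq[symmetric]) (auto simp: less_max_iff_disj)

lemma borel_measurable_log_plus [measurable]: "log_plus \<in> borel_measurable borel"
  by (intro borel_measurable_continuous_onI continuous_intros)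

text \<open>With \<open>u\<close>, \<open>v\<close> the moduli raised to at least 1,
  \<open>|z - t| \<le> u + v \<le> 2 * (u * v)\<close>. Since the right-hand side is at least 1, the
  estimate survives raising the distance to any level \<open>s \<le> 1\<close>.\<close>

lemma ln_dist_le_log_plus:
  assumes "0 < s" "s \<le> 1"
  shows "ln (max s (cmod (z - t))) \<le> ln 2 + log_plus z + log_plus t"
proof -
  define u v where "u = max 1 (cmod z)" and "v = max 1 (cmod t)"
  have uv: "1 \<le> u" "1 \<le> v" by (auto simp: u_def v_def)
  then have "u \<le> u * v" "v \<le> u * v" using mult_left_mono[of 1 v u] mult_right_mono[of 1 u v] by auto
  moreover have "cmod (z - t) \<le> u + v"
    using norm_triangle_ineq4[of z t] by (auto simp: u_def v_def)
  ultimately have "s \<le> 2 * (u * v)" "cmod (z - t) \<le> 2 * (u * v)"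
    using assms uv by linarith+
  then have "ln (max s (cmod (z - t))) \<le> ln (2 * (u * v))"
    using assms uv by (subst ln_le_cancel_iff) (auto simp: less_max_iff_disj mult_pos_pos)
  also have "\<dots> = ln 2 + ln u + ln v"
    using uv by (simp add: ln_mult)
  also have "\<dots> = ln 2 + log_plus z + log_plus t"
    by (simp add: log_plus_def u_def v_def)
  finally show ?thesis .
qed

text \<open>
  The summand \<open>ln 2 + log_plus z + log_plus t\<close> makes the logarithmic kernel nonnegative, so that
  monotone convergence applies to its truncations.
\<close>

definition energy_kernel :: "complex \<Rightarrow> complex \<Rightarrow> ennreal" where
  "energy_kernel z t =
     (if z = t then \<infinity> else ennreal (ln 2 + log_plus z + log_plus t - ln (cmod (z - t))))"

text \<open>Raising the distance to at least \<open>1 / real (Suc m)\<close> makes the kernel finite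
  and continuous across the diagonal. \<open>Suc\<close> keeps this level in the interval from 0
  (excluded) to 1 for every \<open>m\<close>, as nonnegativity requires.\<close>

definition truncated_kernel :: "nat \<Rightarrow> complex \<Rightarrow> complex \<Rightarrow> real" where
  "truncated_kernel m z t =
     ln 2 + log_plus z + log_plus t - ln (max (1 / real (Suc m)) (cmod (z - t)))"

lemma truncated_kernel_nonneg: "0 \<le> truncated_kernel m z t"
  using ln_dist_le_log_plus[of "1 / real (Suc m)" z t] by (simp add: truncated_kernel_def)

lemma truncated_kernel_mono: "truncated_kernel m z t \<le> truncated_kernel (Suc m) z t"
proof -
  have "1 / real (Suc (Suc m)) \<le> 1 / real (Suc m)" by (simp add: field_simps)
  then have "ln (max (1 / real (Suc (Suc m))) (cmod (z - t))) \<le> ln (max (1 / real (Suc m)) (cmod (z - t)))"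
    by (subst ln_le_cancel_iff) (auto simp: less_max_iff_disj simp del: of_nat_Suc)
  then show ?thesis by (simp add: truncated_kernel_def del: of_nat_Suc)
qed

lemma truncated_kernel_le:
  "z \<noteq> t \<Longrightarrow> truncated_kernel m z t \<le> ln 2 + log_plus z + log_plus t - ln (cmod (z - t))"
  unfolding truncated_kernel_def by (intro diff_left_mono, subst ln_le_cancel_iff) (auto simp: less_max_iff_disj)

lemma truncated_kernel_diagonal: "truncated_kernel m z z = ln 2 + 2 * log_plus z + ln (real (Suc m))"
  by (simp add: truncated_kernel_def ln_div max_def del: of_nat_Suc)

text \<open>Truncation and cutoff share one index, giving a single increasing sequence of admissible
  test functions on the product.\<close>

definition cut_kernel :: "nat \<Rightarrow> complex \<Rightarrow> complex \<Rightarrow> real" where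
  "cut_kernel m z t = truncated_kernel m z t * (cutoff (real m) z * cutoff (real m) t)"

lemma cut_kernel_nonneg: "0 \<le> cut_kernel m z t"
  by (simp add: cut_kernel_def truncated_kernel_nonneg cutoff_bounds)

lemma cut_kernel_le: "cut_kernel m z t \<le> truncated_kernel m z t"
  unfolding cut_kernel_def
  by (intro mult_left_le mult_le_one truncated_kernel_nonneg cutoff_bounds)

lemma cut_kernel_mono: "cut_kernel m z t \<le> cut_kernel (Suc m) z t"
  unfolding cut_kernel_def
  by (intro mult_mono truncated_kernel_mono cutoff_mono mult_nonneg_nonneg truncated_kernel_nonneg cutoff_bounds) auto

lemma cut_kernel_nonzero: "cut_kernel m z t \<noteq> 0 \<Longrightarrow> cmod z \<le> real m + 1 \<and> cmod t \<le> real m + 1"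
  using cutoff_nonzero by (auto simp: cut_kernel_def)

lemma cut_kernel_eq:
  "cmod z \<le> real m \<Longrightarrow> cmod t \<le> real m \<Longrightarrow> cut_kernel m z t = truncated_kernel m z t"
  by (simp add: cut_kernel_def cutoff_eq_1)

lemma continuous_on_cut_kernel: "continuous_on UNIV (\<lambda>(z, t). cut_kernel m z t)"
  unfolding case_prod_unfold cut_kernel_def truncated_kernel_def
  by (intro continuous_intros ballI less_imp_neq[symmetric]) (auto simp: less_max_iff_disj)

text \<open>On the diagonal the values eventually exceed \<open>ln (real (Suc m))\<close>, which is
  unbounded. Off the diagonal the sequence becomes constant as soon as \<open>m\<close> is at least
  \<open>|z|\<close>, \<open>|t|\<close> and \<open>1 / |z - t|\<close>.\<close>

lemma SUP_cut_kernel: "(SUP m. ennreal (cut_kernel m z t)) = energy_kernel z t"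
proof (cases "z = t")
  case True
  have "(SUP m. ennreal (cut_kernel m z z)) = Orderings.top"
    unfolding SUP_eq_top_iff
  proof (intro allI impI)
    fix x :: ennreal assume "x < Orderings.top"
    then obtain r where r: "x = ennreal r" "r \<ge> 0" by (cases x) auto
    obtain m :: nat where m: "max (cmod z) (exp r) \<le> real m" using real_arch_simple by blast
    have "r = ln (exp r)" by simp
    also have "\<dots> \<le> ln (real (Suc m))" using m by (subst ln_le_cancel_iff) auto
    also have "\<dots> < truncated_kernel m z z"
      using log_plus_nonneg[of z] by (simp add: truncated_kernel_diagonal add_pos_nonneg del: of_nat_Suc)
    also have "\<dots> = cut_kernel m z z" using m by (simp add: cut_kernel_eq)
    finally have "x < ennreal (cut_kernel m z z)" using r by (simp add: ennreal_lessI)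
    then show "\<exists>m\<in>UNIV. x < ennreal (cut_kernel m z z)" by blast
  qed
  with True show ?thesis by (simp add: energy_kernel_def)
next
  case False
  define K where "K = ln 2 + log_plus z + log_plus t - ln (cmod (z - t))"
  have "(SUP m. ennreal (cut_kernel m z t)) = ennreal K"
  proof (rule antisym)
    show "(SUP m. ennreal (cut_kernel m z t)) \<le> ennreal K"
      unfolding K_def using cut_kernel_le truncated_kernel_le[OF False]
      by (intro SUP_least ennreal_leI) (rule order_trans)
    have nz: "cmod (z - t) > 0" using False by simp
    obtain m :: nat where m: "max (max (cmod z) (cmod t)) (1 / cmod (z - t)) \<le> real m"
      using real_arch_simple by blast
    then have "1 / cmod (z - t) \<le> real (Suc m)" by simp
    then have "1 / real (Suc m) \<le> cmod (z - t)" using nz by (simp add: field_simps del: of_nat_Suc)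
    then have "truncated_kernel m z t = K" by (simp add: truncated_kernel_def K_def max_def del: of_nat_Suc)
    then have "cut_kernel m z t = K" using m by (simp add: cut_kernel_eq)
    then show "ennreal K \<le> (SUP m. ennreal (cut_kernel m z t))" by (metis SUP_upper UNIV_I)
  qed
  with False show ?thesis by (simp add: energy_kernel_def K_def)
qed

section \<open>From the shifted kernel back to the logarithmic energy\<close>

lemma measurable_energy_kernel: "(\<lambda>(z, t). energy_kernel z t) \<in> borel_measurable (borel \<Otimes>\<^sub>M borel)"
  unfolding energy_kernel_def by measurable

lemma measurable_log_kernel: "(\<lambda>(z, t). log_kernel z t) \<in> borel_measurable (borel \<Otimes>\<^sub>M borel)"
  unfolding log_kernel_def by measurable

text \<open>The relation "shifted kernel = logarithmic kernel + shift" is arranged as an equation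
  between sums, so that it can be integrated in \<open>ennreal\<close> without subtraction. On the
  diagonal both sides are infinite.\<close>

lemma energy_kernel_eq:
  "energy_kernel z t + e2ennreal (- log_kernel z t) =
   e2ennreal (log_kernel z t) + (ennreal (ln 2) + ennreal (log_plus z) + ennreal (log_plus t))"
proof (cases "z = t")
  case False
  define u where "u = - ln (cmod (z - t))"
  define c where "c = ln 2 + log_plus z + log_plus t"
  have c: "0 \<le> c" using log_plus_nonneg[of z] log_plus_nonneg[of t] by (simp add: c_def)
  have "0 \<le> truncated_kernel m z t" for m by (rule truncated_kernel_nonneg)
  from order_trans[OF this truncated_kernel_le[OF False]] have uc: "0 \<le> c + u"
    by (simp add: u_def c_def)
  have "energy_kernel z t = ennreal (c + u)" "log_kernel z t = ereal u"
    using False by (simp_all add: energy_kernel_def log_kernel_def u_def c_def ln_div)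
  moreover have "ennreal (ln 2) + ennreal (log_plus z) + ennreal (log_plus t) = ennreal c"
    by (simp add: c_def log_plus_nonneg)
  moreover have "ennreal (c + u) + ennreal (- u) = ennreal u + ennreal c"
    using c uc by (cases "u \<ge> 0") (simp_all add: ennreal_neg add.commute flip: ennreal_plus)
  ultimately show ?thesis by (simp flip: ennreal.abs_eq)
qed (simp add: energy_kernel_def log_kernel_def)

lemma e2ennreal_neg_log_kernel_le:
  "e2ennreal (- log_kernel z t) \<le> ennreal (ln 2) + ennreal (log_plus z) + ennreal (log_plus t)"
proof (cases "z = t")
  case False
  have "0 \<le> truncated_kernel m z t" for m by (rule truncated_kernel_nonneg)
  from order_trans[OF this truncated_kernel_le[OF False]]
  have "ln (cmod (z - t)) \<le> ln 2 + log_plus z + log_plus t" by simp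
  then show ?thesis
    using False by (simp add: log_kernel_def ln_div log_plus_nonneg ennreal_leI flip: ennreal.abs_eq ennreal_plus)
qed (simp add: log_kernel_def e2ennreal_neg)

text \<open>The shift has the finite double integral \<open>ln 2 * m^2 + 2 * m * l\<close> and
  dominates the negative part of the logarithmic kernel, so that part has a finite integral.
  Integrating \<open>energy_kernel_eq\<close> then shows that the positive part is finite as well,
  and the difference defining the energy is one of real numbers.\<close>

lemma log_energy_eq:
  fixes \<nu> :: "complex measure"
  assumes fin: "finite_measure \<nu>" and id: "(\<lambda>z. z) \<in> borel_measurable \<nu>"
    and L: "(\<integral>\<^sup>+z. ennreal (log_plus z) \<partial>\<nu>) = ennreal l" "0 \<le> l"
    and W: "(\<integral>\<^sup>+z. \<integral>\<^sup>+t. energy_kernel z t \<partial>\<nu> \<partial>\<nu>) = ennreal w" "0 \<le> w"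
  defines "m \<equiv> measure \<nu> (space \<nu>)"
  shows "log_energy \<nu> = ereal (w - (ln 2 * m\<^sup>2 + 2 * m * l))"
proof -
  interpret finite_measure \<nu> by fact
  have m0: "0 \<le> m" by (simp add: m_def)
  define k where "k = ln 2 * m\<^sup>2 + 2 * m * l"
  have k0: "0 \<le> k" using m0 L(2) by (simp add: k_def)
  have pair: "(\<lambda>w. w) \<in> \<nu> \<Otimes>\<^sub>M \<nu> \<rightarrow>\<^sub>M borel \<Otimes>\<^sub>M borel"
    using measurable_compose[OF measurable_fst id, of \<nu>] measurable_compose[OF measurable_snd id, of \<nu>]
    by (simp add: measurable_pair_iff comp_def)
  have [measurable]: "(\<lambda>(z, t). energy_kernel z t) \<in> borel_measurable (\<nu> \<Otimes>\<^sub>M \<nu>)"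
    "(\<lambda>(z, t). e2ennreal (log_kernel z t)) \<in> borel_measurable (\<nu> \<Otimes>\<^sub>M \<nu>)"
    "(\<lambda>(z, t). e2ennreal (- log_kernel z t)) \<in> borel_measurable (\<nu> \<Otimes>\<^sub>M \<nu>)"
    using measurable_compose[OF pair measurable_energy_kernel] measurable_compose[OF pair measurable_log_kernel]
    by (simp_all add: case_prod_unfold)
  have [measurable]: "log_plus \<in> borel_measurable \<nu>"
    using measurable_compose[OF id borel_measurable_log_plus] by simp
  have [measurable]: "(\<lambda>(z, t). ennreal (ln 2) + ennreal (log_plus z) + ennreal (log_plus t))
      \<in> borel_measurable (\<nu> \<Otimes>\<^sub>M \<nu>)"
    by measurable
  note double_add = nn_integral_double_add[OF sigma_finite_measure_axioms, where M = \<nu>]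
  define p n where "p = (\<integral>\<^sup>+z. \<integral>\<^sup>+t. e2ennreal (log_kernel z t) \<partial>\<nu> \<partial>\<nu>)"
    and "n = (\<integral>\<^sup>+z. \<integral>\<^sup>+t. e2ennreal (- log_kernel z t) \<partial>\<nu> \<partial>\<nu>)"
  have em: "emeasure \<nu> (space \<nu>) = ennreal m" by (simp add: m_def emeasure_eq_measure)
  have "(\<integral>\<^sup>+z. \<integral>\<^sup>+t. ennreal (ln 2) + ennreal (log_plus z) + ennreal (log_plus t) \<partial>\<nu> \<partial>\<nu>) =
      (\<integral>\<^sup>+z. ennreal (ln 2 * m + l) + ennreal (log_plus z) * ennreal m \<partial>\<nu>)"
    using L(2) m0 by (intro nn_integral_cong)
      (simp add: nn_integral_add em L(1) distrib_right ennreal_mult ac_simps)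
  also have "\<dots> = ennreal (ln 2 * m + l) * ennreal m + ennreal l * ennreal m"
    by (simp add: nn_integral_add nn_integral_multc em L(1))
  also have "\<dots> = ennreal k"
    using L(2) m0 by (simp add: k_def power2_eq_square algebra_simps flip: ennreal_mult ennreal_plus)
  finally have k: "(\<integral>\<^sup>+z. \<integral>\<^sup>+t. ennreal (ln 2) + ennreal (log_plus z) + ennreal (log_plus t) \<partial>\<nu> \<partial>\<nu>) = ennreal k" .
  have "n \<le> ennreal k"
    unfolding n_def k[symmetric] by (intro nn_integral_mono e2ennreal_neg_log_kernel_le)
  then obtain n' where n': "n = ennreal n'" "0 \<le> n'" by (cases n) (auto simp: top_unique)
  have "ennreal w + n = p + ennreal k"
  proof -
    have "(\<integral>\<^sup>+z. \<integral>\<^sup>+t. energy_kernel z t + e2ennreal (- log_kernel z t) \<partial>\<nu> \<partial>\<nu>) = ennreal w + n"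
      unfolding n_def W(1)[symmetric] by (intro double_add) measurable
    moreover have "(\<integral>\<^sup>+z. \<integral>\<^sup>+t. e2ennreal (log_kernel z t) +
        (ennreal (ln 2) + ennreal (log_plus z) + ennreal (log_plus t)) \<partial>\<nu> \<partial>\<nu>) = p + ennreal k"
      unfolding p_def k[symmetric] by (intro double_add) measurable
    ultimately show ?thesis by (simp add: energy_kernel_eq)
  qed
  moreover from this obtain p' where p': "p = ennreal p'" "0 \<le> p'"
    using n' by (cases p) (auto simp flip: ennreal_plus)
  ultimately have "w + n' = p' + k"
    using n' W(2) k0 by (simp flip: ennreal_plus)
  then have "p' - n' = w - k" by simp
  then show ?thesis
    unfolding log_energy_def p_def[symmetric] n_def[symmetric] using p' n' by (simp add: k_def)
qed

text \<open>Lower semicontinuity of the shifted energy. For fixed \<open>m\<close> the double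
  integral of the test function \<open>cut_kernel m\<close> converges, so the asymptotic bound
  carries over to \<open>\<tau>\<close>; the supremum over \<open>m\<close> is taken only
  afterwards.\<close>

lemma weak_star_energy_le:
  assumes conv: "weak_star_tendsto \<mu> \<tau> F" and F: "F \<noteq> bot"
    and prob: "\<forall>\<^sub>F i in F. prob_space (\<mu> i) \<and> sets (\<mu> i) = sets borel"
    and fin: "finite_measure \<tau>" and sets_\<tau>: "sets \<tau> = sets borel"
    and bound: "\<And>m c. c0 < c \<Longrightarrow> \<forall>\<^sub>F i in F. (\<integral>z. \<integral>t. cut_kernel m z t \<partial>\<mu> i \<partial>\<mu> i) \<le> c"
  shows "(\<integral>\<^sup>+z. \<integral>\<^sup>+t. energy_kernel z t \<partial>\<tau> \<partial>\<tau>) \<le> ennreal c0"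
proof -
  interpret finite_measure \<tau> by fact
  interpret pair_sigma_finite \<tau> \<tau> ..
  interpret P: finite_measure "\<tau> \<Otimes>\<^sub>M \<tau>" by (rule finite_measure_pair_measure) (rule fin)+
  have meas: "(\<lambda>(z, t). cut_kernel m z t) \<in> borel_measurable (\<tau> \<Otimes>\<^sub>M \<tau>)" for m
  proof -
    have "sets (\<tau> \<Otimes>\<^sub>M \<tau>) = sets (borel :: (complex \<times> complex) measure)"
      using sets_pair_measure_cong[OF sets_\<tau> sets_\<tau>] by (metis borel_prod)
    then show ?thesis using continuous_on_cut_kernel by (rule continuous_imp_borel_measurable)
  qed
  have int: "integrable (\<tau> \<Otimes>\<^sub>M \<tau>) (\<lambda>(z, t). cut_kernel m z t)" for m
  proof -
    have "(case w of (z, t) \<Rightarrow> cut_kernel m z t) \<noteq> 0 \<Longrightarrow> w \<in> cball 0 (real m + 1) \<times> cball 0 (real m + 1)" for w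
      using cut_kernel_nonzero by (cases w) auto
    then obtain B where "\<forall>w. \<bar>case w of (z, t) \<Rightarrow> cut_kernel m z t\<bar> \<le> B"
      using continuous_compact_support_bounded[OF compact_Times[OF compact_cball compact_cball]
          continuous_on_subset[OF continuous_on_cut_kernel subset_UNIV]] by blast
    then show ?thesis using meas by (intro P.integrable_const_bound[of _ B]) auto
  qed
  have le: "(\<integral>z. \<integral>t. cut_kernel m z t \<partial>\<tau> \<partial>\<tau>) \<le> c0" for m
  proof (rule dense_ge)
    fix c assume "c0 < c"
    show "(\<integral>z. \<integral>t. cut_kernel m z t \<partial>\<tau> \<partial>\<tau>) \<le> c"
      using weak_star_tendsto_double_integral[OF conv prob fin sets_\<tau> continuous_on_cut_kernel cut_kernel_nonzero]
        bound[OF \<open>c0 < c\<close>, of m] F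
      by (rule tendsto_upperbound)
  qed
  have "(\<integral>\<^sup>+z. \<integral>\<^sup>+t. energy_kernel z t \<partial>\<tau> \<partial>\<tau>) = (SUP m. \<integral>\<^sup>+z. \<integral>\<^sup>+t. ennreal (cut_kernel m z t) \<partial>\<tau> \<partial>\<tau>)"
    unfolding SUP_cut_kernel[symmetric]
  proof (intro nn_integral_double_monotone_convergence ennreal_leI cut_kernel_mono)
    show "sigma_finite_measure \<tau>" using fin by (rule finite_measure.axioms(1))
    show "(\<lambda>(z, t). ennreal (cut_kernel m z t)) \<in> borel_measurable (\<tau> \<Otimes>\<^sub>M \<tau>)" for m
      using measurable_compose[OF meas measurable_ennreal] by (simp add: case_prod_unfold)
  qed
  also have "\<dots> \<le> ennreal c0"
  proof (rule SUP_least)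
    fix m
    have "(\<integral>\<^sup>+z. \<integral>\<^sup>+t. ennreal (cut_kernel m z t) \<partial>\<tau> \<partial>\<tau>) =
        (\<integral>\<^sup>+w. ennreal (case w of (z, t) \<Rightarrow> cut_kernel m z t) \<partial>(\<tau> \<Otimes>\<^sub>M \<tau>))"
      using measurable_compose[OF meas measurable_ennreal, of m]
      by (subst nn_integral_double_eq[OF finite_measure.axioms(1)[OF fin]]) (simp_all add: case_prod_unfold)
    also have "\<dots> = ennreal (\<integral>w. (case w of (z, t) \<Rightarrow> cut_kernel m z t) \<partial>(\<tau> \<Otimes>\<^sub>M \<tau>))"
      using int[of m] cut_kernel_nonneg by (intro nn_integral_eq_integral) auto
    also have "\<dots> = ennreal (\<integral>z. \<integral>t. cut_kernel m z t \<partial>\<tau> \<partial>\<tau>)"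
      using integral_fst[OF int] by simp
    finally show "(\<integral>\<^sup>+z. \<integral>\<^sup>+t. ennreal (cut_kernel m z t) \<partial>\<tau> \<partial>\<tau>) \<le> ennreal c0"
      using le[of m] by (simp add: ennreal_leI)
  qed
  finally show ?thesis .
qed

section \<open>Energy of the zeros\<close>

lemma rsquarefree_prod_linear_imp_inj:
  fixes x :: "nat \<Rightarrow> complex"
  assumes "rsquarefree (smult a (\<Prod>k<n. [:- x k, 1:]))"
  shows "inj_on x {..<n}"
proof (rule inj_onI, rule ccontr)
  fix j k assume jk: "j \<in> {..<n}" "k \<in> {..<n}" "x j = x k" "j \<noteq> k"
  define p where "p = smult a (\<Prod>k<n. [:- x k, 1:])"
  have "poly p (x k) = 0" using jk by (auto simp: p_def poly_prod)
  moreover have "(\<Prod>i\<in>{..<n} - {k}. x k - x i) = 0" using jk by (intro prod_zero bexI[of _ j]) auto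
  then have "poly (pderiv p) (x k) = 0"
    using jk by (simp add: p_def pderiv_smult pderiv_prod_linear_factor_at_root)
  ultimately show False using assms unfolding rsquarefree_roots p_def by blast
qed

text \<open>A nonzero integer has modulus at least 1. This lets a bound on
  \<open>ln |a| + \<Sum> ln+ |x k|\<close> control the second summand alone, and it forces Mahler
  measures to be at least 1.\<close>

lemma ln_norm_leading_coeff_nonneg:
  fixes x :: "nat \<Rightarrow> complex"
  assumes a: "a \<noteq> 0" and Ints: "\<And>i. coeff (smult a (\<Prod>k<n. [:- x k, 1:])) i \<in> \<int>"
  shows "0 \<le> ln (cmod a)"
proof -
  have "lead_coeff (smult a (\<Prod>k<n. [:- x k, 1:])) = a"
    by (simp add: lead_coeff_prod)
  then obtain i where "a = of_int i"
    using Ints by (metis Ints_cases)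
  with a show ?thesis by (cases "i > 0") auto
qed

text \<open>The discriminant gives \<open>S \<ge> - 2 n ln |a|\<close> for the sum \<open>S\<close>
  of the logarithmic distances, while the \<open>log_plus\<close> terms add up to
  \<open>2 (n - 1) L\<close>. Together they are at most \<open>2 n (ln |a| + L)\<close>, which the
  Mahler measure controls even when \<open>ln |a|\<close> and \<open>L\<close> are both
  large.\<close>

lemma sum_off_diagonal_bound:
  fixes x :: "nat \<Rightarrow> complex"
  assumes a: "a \<noteq> 0" and p: "p = smult a (\<Prod>k<n. [:- x k, 1:])"
    and Ints: "\<And>i. coeff p i \<in> \<int>" and sf: "rsquarefree p"
    and M: "ln (mahler_measure p) \<le> real n * c"
  shows "(\<Sum>k<n. log_plus (x k)) \<le> real n * c"
    and "(\<Sum>j<n. \<Sum>k\<in>{..<n} - {j}. ln 2 + log_plus (x j) + log_plus (x k) - ln (cmod (x j - x k)))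
      \<le> (real n)\<^sup>2 * (ln 2 + 2 * c)"
proof -
  define L where "L = (\<Sum>k<n. log_plus (x k))"
  have inj: "inj_on x {..<n}"
    using sf unfolding p by (rule rsquarefree_prod_linear_imp_inj)
  have L0: "0 \<le> L" unfolding L_def by (intro sum_nonneg log_plus_nonneg)
  have a0: "0 \<le> ln (cmod a)"
    using a Ints unfolding p by (rule ln_norm_leading_coeff_nonneg)
  have sum_le: "ln (cmod a) + L \<le> real n * c"
    using ln_mahler_measure_ge[OF a p] M by (simp add: L_def log_plus_def)
  then show "(\<Sum>k<n. log_plus (x k)) \<le> real n * c" using a0 by (simp add: L_def)
  define S where "S = (\<Sum>j<n. \<Sum>k\<in>{..<n} - {j}. ln (cmod (x j - x k)))"
  have neq: "x j \<noteq> x k" if "j < n" "k \<in> {..<n} - {j}" for j k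
    using inj that by (auto dest: inj_onD)
  have S: "0 \<le> 2 * real n * ln (cmod a) + S"
  proof -
    define D where "D = (\<Prod>j<n. \<Prod>k\<in>{..<n} - {j}. cmod (x j - x k))"
    have "ln D = (\<Sum>j<n. ln (\<Prod>k\<in>{..<n} - {j}. cmod (x j - x k)))"
      unfolding D_def using neq by (intro ln_prod) auto
    also have "\<dots> = S"
      unfolding S_def using neq by (intro sum.cong refl ln_prod) auto
    finally have lnS: "ln D = S" .
    have "0 < D"
      unfolding D_def using neq by (intro prod_pos) auto
    then have "ln (cmod a ^ (2 * n) * D) = 2 * real n * ln (cmod a) + S"
      using a by (simp add: ln_mult lnS ln_realpow)
    then show ?thesis
      using ln_ge_zero[OF discriminant_ge_1[OF p a inj Ints]] by (simp add: D_def)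
  qed
  have count: "(\<Sum>k\<in>{..<n} - {j}. C) = (real n - 1) * C" if "j < n" for j and C :: real
    using that by (simp add: of_nat_diff)
  have "(\<Sum>k\<in>{..<n} - {j}. ln 2 + log_plus (x j) + log_plus (x k) - ln (cmod (x j - x k))) =
      (real n - 1) * (ln 2 + log_plus (x j)) + (L - log_plus (x j)) -
      (\<Sum>k\<in>{..<n} - {j}. ln (cmod (x j - x k)))" if "j < n" for j
  proof -
    have "(\<Sum>k\<in>{..<n} - {j}. log_plus (x k)) = L - log_plus (x j)"
      using that unfolding L_def by (subst sum_diff1) auto
    then show ?thesis
      unfolding sum_subtractf sum.distrib count[OF that] by (simp add: algebra_simps)
  qed
  then have "(\<Sum>j<n. \<Sum>k\<in>{..<n} - {j}. ln 2 + log_plus (x j) + log_plus (x k) - ln (cmod (x j - x k))) =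
      (\<Sum>j<n. (real n - 1) * (ln 2 + log_plus (x j)) + (L - log_plus (x j)) -
        (\<Sum>k\<in>{..<n} - {j}. ln (cmod (x j - x k))))"
    by (intro sum.cong) auto
  also have "\<dots> = (real n - 1) * (real n * ln 2 + L) + (real n * L - L) - S"
    by (simp add: sum.distrib sum_subtractf S_def L_def flip: sum_distrib_left)
  also have "\<dots> \<le> (real n)\<^sup>2 * ln 2 + 2 * real n * (ln (cmod a) + L)"
  proof -
    \<comment> \<open>The subtracted bracket is a sum of nonnegative terms, the last one by the
      discriminant bound \<open>S\<close>.\<close>
    have "(real n - 1) * (real n * ln 2 + L) + (real n * L - L) - S =
        (real n)\<^sup>2 * ln 2 + 2 * real n * (ln (cmod a) + L) -
        (real n * ln 2 + 2 * L + (2 * real n * ln (cmod a) + S))"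
      by (simp add: algebra_simps power2_eq_square)
    moreover have "0 \<le> real n * ln 2" by simp
    ultimately show ?thesis using S L0 by linarith
  qed
  also have "\<dots> \<le> (real n)\<^sup>2 * ln 2 + 2 * real n * (real n * c)"
    using sum_le by (intro add_left_mono mult_left_mono) auto
  also have "\<dots> = (real n)\<^sup>2 * (ln 2 + 2 * c)"
    by (simp add: algebra_simps power2_eq_square)
  finally show "(\<Sum>j<n. \<Sum>k\<in>{..<n} - {j}. ln 2 + log_plus (x j) + log_plus (x k) - ln (cmod (x j - x k)))
      \<le> (real n)\<^sup>2 * (ln 2 + 2 * c)" .
qed

text \<open>Counting measures have atoms, so the diagonal contributes to the double sum. Truncation
  bounds each diagonal term by \<open>ln 2 + 2 * log_plus (x j) + ln (real (Suc m))\<close>, and all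
  of them together by a multiple of \<open>n\<close>, for fixed \<open>m\<close> and
  \<open>c\<close>.\<close>

lemma sum_cut_kernel_le:
  fixes x :: "nat \<Rightarrow> complex"
  assumes inj: "inj_on x {..<n}" and L: "(\<Sum>k<n. log_plus (x k)) \<le> real n * c"
    and off: "(\<Sum>j<n. \<Sum>k\<in>{..<n} - {j}. ln 2 + log_plus (x j) + log_plus (x k) - ln (cmod (x j - x k)))
      \<le> (real n)\<^sup>2 * (ln 2 + 2 * c)"
  shows "(\<Sum>j<n. \<Sum>k<n. cut_kernel m (x j) (x k)) \<le>
    (real n)\<^sup>2 * (ln 2 + 2 * c) + real n * (ln 2 + 2 * c + ln (real (Suc m)))"
proof -
  have "(\<Sum>k<n. cut_kernel m (x j) (x k)) \<le> (ln 2 + 2 * log_plus (x j) + ln (real (Suc m))) +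
      (\<Sum>k\<in>{..<n} - {j}. ln 2 + log_plus (x j) + log_plus (x k) - ln (cmod (x j - x k)))"
    if "j < n" for j
  proof -
    have "cut_kernel m (x j) (x k) \<le> ln 2 + log_plus (x j) + log_plus (x k) - ln (cmod (x j - x k))"
      if "k \<in> {..<n} - {j}" for k
      using that \<open>j < n\<close> inj by (intro order_trans[OF cut_kernel_le truncated_kernel_le]) (auto dest: inj_onD)
    moreover have "cut_kernel m (x j) (x j) \<le> ln 2 + 2 * log_plus (x j) + ln (real (Suc m))"
      using cut_kernel_le[of m "x j" "x j"] by (simp add: truncated_kernel_diagonal del: of_nat_Suc)
    ultimately show ?thesis
      using that by (subst sum.remove[of _ j]) (auto intro!: add_mono sum_mono)
  qed
  then have "(\<Sum>j<n. \<Sum>k<n. cut_kernel m (x j) (x k)) \<le>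
      (\<Sum>j<n. (ln 2 + 2 * log_plus (x j) + ln (real (Suc m))) +
      (\<Sum>k\<in>{..<n} - {j}. ln 2 + log_plus (x j) + log_plus (x k) - ln (cmod (x j - x k))))"
    by (intro sum_mono) auto
  also have "\<dots> = real n * (ln 2 + ln (real (Suc m))) + 2 * (\<Sum>k<n. log_plus (x k)) +
      (\<Sum>j<n. \<Sum>k\<in>{..<n} - {j}. ln 2 + log_plus (x j) + log_plus (x k) - ln (cmod (x j - x k)))"
    by (simp add: sum.distrib distrib_left del: of_nat_Suc flip: sum_distrib_left)
  also have "\<dots> \<le> real n * (ln 2 + ln (real (Suc m))) + 2 * (real n * c) + (real n)\<^sup>2 * (ln 2 + 2 * c)"
    using L off by (intro add_mono) auto
  finally show ?thesis by (simp add: algebra_simps)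
qed

section \<open>Integrals against the counting measures of the zeros\<close>

lemma normalized_counting_measure_props:
  fixes f :: "complex \<Rightarrow> real"
  assumes "n \<ge> 1"
  shows "prob_space (normalized_counting_measure n \<alpha>)"
    and "sets (normalized_counting_measure n \<alpha>) = sets borel"
    and "f \<in> borel_measurable borel \<Longrightarrow> integrable (normalized_counting_measure n \<alpha>) f"
    and "f \<in> borel_measurable borel \<Longrightarrow>
      (\<integral>z. f z \<partial>normalized_counting_measure n \<alpha>) = (\<Sum>k<n. f (\<alpha> (Suc k))) / real n"
proof -
  let ?U = "uniform_count_measure {1..n}"
  have meas: "\<alpha> \<in> measurable ?U borel"
    by (simp add: measurable_def space_uniform_count_measure sets_uniform_count_measure)
  show "sets (normalized_counting_measure n \<alpha>) = sets borel"
    by (simp add: normalized_counting_measure_def)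
  show "prob_space (normalized_counting_measure n \<alpha>)"
    unfolding normalized_counting_measure_def using assms meas
    by (intro prob_space.prob_space_distr prob_space_uniform_count_measure) auto
  show "integrable (normalized_counting_measure n \<alpha>) f" if f: "f \<in> borel_measurable borel"
    unfolding normalized_counting_measure_def
    by (subst integrable_distr_eq[OF meas f])
       (simp add: uniform_count_measure_def integrable_point_measure_finite)
  show "(\<integral>z. f z \<partial>normalized_counting_measure n \<alpha>) = (\<Sum>k<n. f (\<alpha> (Suc k))) / real n"
    if f: "f \<in> borel_measurable borel"
    unfolding normalized_counting_measure_def
    by (subst integral_distr[OF meas f])
       (simp add: integral_uniform_count_measure prod.atLeast1_atMost_eq sum.atLeast1_atMost_eq)
qed

lemma double_integral_normalized_counting_measure:
  fixes f :: "complex \<Rightarrow> complex \<Rightarrow> real" and \<alpha> :: "nat \<Rightarrow> complex"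
  assumes n: "n \<ge> 1" and cont: "continuous_on UNIV (\<lambda>(z, t). f z t)"
  defines "\<mu> \<equiv> normalized_counting_measure n \<alpha>"
  shows "(\<integral>z. \<integral>t. f z t \<partial>\<mu> \<partial>\<mu>) = (\<Sum>j<n. \<Sum>k<n. f (\<alpha> (Suc j)) (\<alpha> (Suc k))) / (real n)\<^sup>2"
proof -
  have [measurable]: "(\<lambda>(z, t). f z t) \<in> borel_measurable (borel \<Otimes>\<^sub>M borel)"
    unfolding borel_prod using cont by (rule borel_measurable_continuous_onI)
  have "(\<integral>t. f z t \<partial>\<mu>) = (\<Sum>k<n. f z (\<alpha> (Suc k))) / real n" for z
    unfolding \<mu>_def by (rule normalized_counting_measure_props(4)[OF n]) measurable
  then have "(\<integral>z. \<integral>t. f z t \<partial>\<mu> \<partial>\<mu>) = (\<integral>z. (\<Sum>k<n. f z (\<alpha> (Suc k))) / real n \<partial>\<mu>)"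
    by simp
  also have "\<dots> = (\<Sum>j<n. (\<Sum>k<n. f (\<alpha> (Suc j)) (\<alpha> (Suc k))) / real n) / real n"
    unfolding \<mu>_def by (rule normalized_counting_measure_props(4)[OF n]) measurable
  finally show ?thesis
    by (simp add: power2_eq_square sum_divide_distrib)
qed

text \<open>No mass escapes to infinity, because \<open>log_plus\<close> is large there but has bounded integrals.\<close>

lemma weak_star_limit_mass:
  assumes conv: "weak_star_tendsto \<mu> \<tau> F" and F: "F \<noteq> bot"
    and prob: "\<forall>\<^sub>F i in F. prob_space (\<mu> i) \<and> sets (\<mu> i) = sets borel"
    and sets_\<tau>: "sets \<tau> = sets borel" and loc: "\<And>K. compact K \<Longrightarrow> emeasure \<tau> K < \<infinity>"
    and bound: "\<forall>\<^sub>F i in F. integrable (\<mu> i) log_plus \<and> (\<integral>z. log_plus z \<partial>\<mu> i) \<le> c"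
  shows "emeasure \<tau> UNIV = 1"
proof -
  have space: "space \<tau> = UNIV" using sets_eq_imp_space_eq[OF sets_\<tau>] by simp
  have "\<forall>\<^sub>F i in F. integrable (\<mu> i) (\<lambda>_. 1 :: real) \<and> (\<integral>z. 1 \<partial>\<mu> i) \<le> (1 :: real)"
    using prob
  proof eventually_elim
    case (elim i)
    then interpret prob_space "\<mu> i" by simp
    show ?case by (simp add: prob_space)
  qed
  from weak_star_nn_integral_le[OF conv F sets_\<tau> loc _ _ this]
  have le: "emeasure \<tau> UNIV \<le> 1" by (simp add: space)
  interpret finite_measure \<tau>
    using le by (intro finite_measureI) (auto simp: space top_unique)
  have ge: "1 - c / ln R \<le> measure \<tau> UNIV" if "R > 1" for R
  proof -
    \<comment> \<open>Markov's inequality in pointwise form, with the continuous cutoff in place of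
      an indicator so that the weak* limit can be taken.\<close>
    have lower: "1 - log_plus z / ln R \<le> cutoff R z" for z
    proof (cases "cmod z \<le> R")
      case True
      then show ?thesis using \<open>R > 1\<close> log_plus_nonneg[of z] by (simp add: cutoff_eq_1)
    next
      case False
      then have "ln R \<le> log_plus z"
        using \<open>R > 1\<close> unfolding log_plus_def by (subst ln_le_cancel_iff) auto
      then have "1 \<le> log_plus z / ln R" using \<open>R > 1\<close> by simp
      then show ?thesis using cutoff_bounds[of R z] by linarith
    qed
    have cont: "continuous_on UNIV (cutoff R)" by (intro continuous_intros)
    have "1 - c / ln R \<le> (\<integral>z. cutoff R z \<partial>\<tau>)"
    proof (rule tendsto_lowerbound[OF weak_star_tendstoD[OF conv cont cutoff_nonzero] _ F])
      show "\<forall>\<^sub>F i in F. 1 - c / ln R \<le> (\<integral>z. cutoff R z \<partial>\<mu> i)"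
        using prob bound
      proof eventually_elim
        case (elim i)
        then interpret P: prob_space "\<mu> i" by simp
        have "cutoff R \<in> borel_measurable (\<mu> i)"
          using conjunct2[OF elim(1)] cont by (rule continuous_imp_borel_measurable)
        then have int: "integrable (\<mu> i) (cutoff R)"
          using cutoff_bounds by (intro P.integrable_const_bound[of _ 1]) auto
        have "1 - c / ln R \<le> 1 - (\<integral>z. log_plus z \<partial>\<mu> i) / ln R"
          using elim(2) \<open>R > 1\<close> by (simp add: divide_right_mono)
        also have "\<dots> = (\<integral>z. 1 - log_plus z / ln R \<partial>\<mu> i)"
          using elim(2) by (simp add: P.prob_space)
        also have "\<dots> \<le> (\<integral>z. cutoff R z \<partial>\<mu> i)"
          using elim(2) int lower by (intro integral_mono) auto
        finally show ?case .
      qed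
    qed
    also have "\<dots> \<le> (\<integral>z. 1 \<partial>\<tau>)"
      using cutoff_bounds by (intro integral_mono') auto
    finally show ?thesis by (simp add: space)
  qed
  have "1 \<le> measure \<tau> UNIV"
  proof (rule tendsto_upperbound)
    show "((\<lambda>R. 1 - c / ln R) \<longlongrightarrow> 1) at_top" by real_asymp
    show "\<forall>\<^sub>F R in at_top. 1 - c / ln R \<le> measure \<tau> UNIV"
      using eventually_gt_at_top[of "1::real"] by eventually_elim (rule ge)
  qed simp
  then have "1 \<le> emeasure \<tau> UNIV"
    by (simp add: emeasure_eq_measure)
  with le show ?thesis by simp
qed

text \<open>The energy equals \<open>w - ln 2 * m^2 - 2 * m * l\<close> with
  \<open>0 \<le> w \<le> ln 2 + 2 * h\<close> and \<open>0 \<le> l \<le> h\<close>, since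
  restriction cannot increase integrals of nonnegative functions. The lower bound drops
  \<open>w\<close>, the upper bound drops \<open>2 * m * l\<close>. Allowing any Borel set
  \<open>A\<close> covers the discs and the whole plane at once.\<close>

lemma log_energy_restrict_bounds:
  fixes \<tau> :: "complex measure"
  assumes sets_\<tau>: "sets \<tau> = sets borel" and mass: "emeasure \<tau> UNIV = 1"
    and A: "A \<in> sets borel" and h: "0 \<le> h"
    and L: "(\<integral>\<^sup>+z. ennreal (log_plus z) \<partial>\<tau>) \<le> ennreal h"
    and W: "(\<integral>\<^sup>+z. \<integral>\<^sup>+t. energy_kernel z t \<partial>\<tau> \<partial>\<tau>) \<le> ennreal (ln 2 + 2 * h)"
  shows "\<exists>e. log_energy (restrict_space \<tau> A) = ereal e \<and>
    - ln 2 - 2 * measure \<tau> A * h \<le> e \<and> e \<le> (1 - measure \<tau> A) * ln 4 + 2 * h"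
proof -
  have space: "space \<tau> = UNIV" using sets_eq_imp_space_eq[OF sets_\<tau>] by simp
  interpret prob_space \<tau> by (rule prob_spaceI) (simp add: space mass)
  define \<nu> where "\<nu> = restrict_space \<tau> A"
  define m where "m = measure \<tau> A"
  have m: "0 \<le> m" "m \<le> 1" by (auto simp: m_def)
  have A_\<tau>: "A \<in> sets \<tau>" using A by (simp add: sets_\<tau>)
  then have A': "A \<inter> space \<tau> \<in> sets \<tau>" by (simp add: space)
  have fin: "finite_measure \<nu>"
    unfolding \<nu>_def using finite_measure_axioms A_\<tau> by (rule finite_measure_restrict_space)
  have m_eq: "measure \<nu> (space \<nu>) = m"
    using A by (simp add: \<nu>_def measure_restrict_space space_restrict_space space m_def sets_\<tau>)
  have "(\<lambda>z. z) \<in> borel_measurable \<tau>"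
    using sets_\<tau> by (rule continuous_imp_borel_measurable) (intro continuous_intros)
  then have id: "(\<lambda>z. z) \<in> borel_measurable \<nu>"
    unfolding \<nu>_def by (rule measurable_restrict_space1)
  have restrict_le: "(\<integral>\<^sup>+z. f z \<partial>\<nu>) \<le> (\<integral>\<^sup>+z. f z \<partial>\<tau>)" for f
    unfolding \<nu>_def nn_integral_restrict_space[OF A']
    by (intro nn_integral_mono) (simp add: indicator_def)
  have "(\<integral>\<^sup>+z. ennreal (log_plus z) \<partial>\<nu>) \<le> ennreal h"
    using restrict_le L by (rule order_trans)
  then obtain l where l: "(\<integral>\<^sup>+z. ennreal (log_plus z) \<partial>\<nu>) = ennreal l" "0 \<le> l" "l \<le> h"
    using h by (cases "\<integral>\<^sup>+z. ennreal (log_plus z) \<partial>\<nu>") (auto simp: top_unique)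
  have "(\<integral>\<^sup>+z. \<integral>\<^sup>+t. energy_kernel z t \<partial>\<nu> \<partial>\<nu>) \<le> (\<integral>\<^sup>+z. \<integral>\<^sup>+t. energy_kernel z t \<partial>\<tau> \<partial>\<tau>)"
    by (rule order_trans[OF nn_integral_mono[OF restrict_le] restrict_le])
  then have "(\<integral>\<^sup>+z. \<integral>\<^sup>+t. energy_kernel z t \<partial>\<nu> \<partial>\<nu>) \<le> ennreal (ln 2 + 2 * h)"
    using W by (rule order_trans)
  moreover have "0 \<le> ln 2 + 2 * h" using h by simp
  ultimately obtain w where w: "(\<integral>\<^sup>+z. \<integral>\<^sup>+t. energy_kernel z t \<partial>\<nu> \<partial>\<nu>) = ennreal w" "0 \<le> w" "w \<le> ln 2 + 2 * h"
    by (cases "\<integral>\<^sup>+z. \<integral>\<^sup>+t. energy_kernel z t \<partial>\<nu> \<partial>\<nu>") (auto simp: top_unique simp del: ennreal_plus)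
  define e where "e = w - (ln 2 * m\<^sup>2 + 2 * m * l)"
  have "log_energy \<nu> = ereal e"
    using log_energy_eq[OF fin id l(1,2) w(1,2)] by (simp add: m_eq e_def)
  moreover have "- ln 2 - 2 * m * h \<le> e"
  proof -
    have "ln 2 * m\<^sup>2 \<le> ln 2 * (1::real)"
      using m by (intro mult_left_mono power_le_one) auto
    moreover have "2 * m * l \<le> 2 * m * h" using m l by (intro mult_left_mono) auto
    ultimately show ?thesis using w(2) unfolding e_def by linarith
  qed
  moreover have "e \<le> (1 - m) * ln 4 + 2 * h"
  proof -
    \<comment> \<open>This square expands to \<open>1 - m^2 \<le> 2 * (1 - m)\<close>, and the
      factor 2 turns \<open>ln 2\<close> into \<open>ln 4\<close>.\<close>
    have "0 \<le> ln 2 * (1 - m)\<^sup>2" by simp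
    then have "ln 2 * (1 - m\<^sup>2) \<le> 2 * ln 2 * (1 - m)" by (simp add: power2_eq_square algebra_simps)
    moreover have "ln (4::real) = 2 * ln 2" using ln_realpow[of 2 2] by simp
    moreover have "0 \<le> 2 * m * l" using m l by simp
    ultimately show ?thesis using w by (simp add: e_def algebra_simps)
  qed
  ultimately show ?thesis unfolding \<nu>_def m_def by blast
qed

theorem theorem2p1:
  fixes P :: "nat \<Rightarrow> complex poly"
    and a :: "nat \<Rightarrow> complex"
    and \<alpha> :: "nat \<Rightarrow> nat \<Rightarrow> complex"
    and \<tau> :: "complex measure"
    and N :: "nat set"
    and H :: real
  assumes P_eq: "\<And>n. n \<ge> 1 \<Longrightarrow> P n = smult (a n) (\<Prod>k = 1..n. [:- \<alpha> n k, 1:])"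
    and a_nonzero: "\<And>n. n \<ge> 1 \<Longrightarrow> a n \<noteq> 0"
    and integer_coeffs: "\<And>n i. n \<ge> 1 \<Longrightarrow> coeff (P n) i \<in> \<int>"
    and simple_zeros: "\<And>n. n \<ge> 1 \<Longrightarrow> rsquarefree (P n)"
    and N: "N \<subseteq> {1..}" "infinite N"
    and borel_\<tau>: "sets \<tau> = sets borel"
    and locally_finite_\<tau>: "\<And>K. compact K \<Longrightarrow> emeasure \<tau> K < \<infinity>"
    and convergence:
      "weak_star_tendsto (\<lambda>n. normalized_counting_measure n (\<alpha> n)) \<tau>
         (inf sequentially (principal N))"
    and H: "Limsup (inf sequentially (principal N))
              (\<lambda>n. ereal (root n (mahler_measure (P n)))) = ereal H"
  shows "emeasure \<tau> UNIV = 1 \<and>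
    \<bar>log_energy \<tau>\<bar> \<noteq> \<infinity> \<and>
    enn2ereal (\<integral>\<^sup>+z. ennreal (max 0 (ln (cmod z))) \<partial>\<tau>) \<le> ereal (ln H) \<and>
    countable {R :: real. R > 1 \<and>
           \<not> (ereal (- ln 2 - 2 * measure \<tau> (cball 0 R) * ln H)
                \<le> log_energy (restrict_space \<tau> (cball 0 R)) \<and>
              log_energy (restrict_space \<tau> (cball 0 R))
                \<le> ereal ((1 - measure \<tau> (ball 0 R)) * ln 4 + 2 * ln H))}"
proof -
  define F where "F = inf sequentially (principal N)"
  define \<mu> where "\<mu> n = normalized_counting_measure n (\<alpha> n)" for n
  \<comment> \<open>The zeros are numbered from 1 in the statement and from 0 in the lemmas on sums
    over \<open>{..<n}\<close>.\<close>
  define x where "x n k = \<alpha> n (Suc k)" for n k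
  have F: "F \<noteq> bot"
  proof
    assume "F = bot"
    then have "\<forall>\<^sub>F n in sequentially. n \<notin> N"
      unfolding F_def trivial_limit_def eventually_inf_principal by simp
    then obtain n0 where "\<And>n. n \<ge> n0 \<Longrightarrow> n \<notin> N" unfolding eventually_sequentially by blast
    then have "N \<subseteq> {..<n0}" by (auto simp: not_le[symmetric])
    then show False using N(2) finite_subset by blast
  qed
  have ev_N: "\<forall>\<^sub>F n in F. n \<ge> 1"
    unfolding F_def eventually_inf_principal using N(1) by (intro always_eventually) auto
  have conv: "weak_star_tendsto \<mu> \<tau> F" using convergence unfolding F_def \<mu>_def[abs_def] .
  have prob: "\<forall>\<^sub>F n in F. prob_space (\<mu> n) \<and> sets (\<mu> n) = sets borel"
    using ev_N by eventually_elim (simp add: \<mu>_def normalized_counting_measure_props)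
  have P: "P n = smult (a n) (\<Prod>k<n. [:- x n k, 1:])" if "n \<ge> 1" for n
    using P_eq[OF that] by (simp add: x_def prod.atLeast1_atMost_eq)
  have M_pos: "0 < mahler_measure p" for p by (simp add: mahler_measure_def)
  have ln_root_M: "ln (root n (mahler_measure (P n))) = ln (mahler_measure (P n)) / real n"
    if "n \<ge> 1" for n
    using that M_pos by (intro ln_root) auto
  \<comment> \<open>Integrality makes every Mahler measure at least 1. Hence \<open>ln H\<close> is
    nonnegative and \<open>ennreal (ln H)\<close> is not truncated to 0.\<close>
  have "1 \<le> H"
  proof -
    have "\<forall>\<^sub>F n in F. ereal 1 \<le> ereal (root n (mahler_measure (P n)))"
      using ev_N
    proof eventually_elim
      case (elim n)
      have "0 \<le> ln (cmod (a n))"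
        using a_nonzero[OF elim] integer_coeffs[OF elim] unfolding P[OF elim]
        by (rule ln_norm_leading_coeff_nonneg)
      moreover have "0 \<le> (\<Sum>k<n. ln (max 1 (cmod (x n k))))"
        by (intro sum_nonneg) auto
      ultimately have "0 \<le> ln (mahler_measure (P n))"
        using ln_mahler_measure_ge[OF a_nonzero[OF elim] P[OF elim]] by linarith
      then have "1 \<le> mahler_measure (P n)" using M_pos[of "P n"] by simp
      then show ?case using elim by simp
    qed
    then have "ereal 1 \<le> Limsup F (\<lambda>n. ereal (root n (mahler_measure (P n))))"
      by (rule le_Limsup[OF F])
    then show ?thesis using H by (simp add: F_def)
  qed
  then have h: "0 \<le> ln H" by simp
  \<comment> \<open>An upper limit yields eventual bounds only for constants strictly above
    \<open>ln H\<close>; the slack is removed after passing to \<open>\<tau>\<close>.\<close>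
  have ev_M: "\<forall>\<^sub>F n in F. n \<ge> 1 \<and> ln (mahler_measure (P n)) \<le> real n * c" if "ln H < c" for c
  proof -
    have "H = exp (ln H)" using \<open>1 \<le> H\<close> by simp
    also have "\<dots> < exp c" using that by simp
    finally have "H < exp c" .
    then have "\<forall>\<^sub>F n in F. ereal (root n (mahler_measure (P n))) < ereal (exp c)"
      using H by (intro Limsup_lessD) (simp add: F_def)
    then show ?thesis
      using ev_N
    proof eventually_elim
      case (elim n)
      have "0 < root n (mahler_measure (P n))" using elim M_pos by simp
      then have "ln (root n (mahler_measure (P n))) < ln (exp c)"
        using elim(1) by (subst ln_less_cancel_iff) auto
      then show ?case using elim(2) by (simp add: ln_root_M field_simps)
    qed
  qed
  have ev_bounds: "\<forall>\<^sub>F n in F. n \<ge> 1 \<and> (\<Sum>k<n. log_plus (x n k)) \<le> real n * c \<and>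
      (\<forall>m. (\<Sum>j<n. \<Sum>k<n. cut_kernel m (x n j) (x n k)) \<le>
        (real n)\<^sup>2 * (ln 2 + 2 * c) + real n * (ln 2 + 2 * c + ln (real (Suc m))))"
    if "ln H < c" for c
    using ev_M[OF that]
  proof eventually_elim
    case (elim n)
    then have n: "n \<ge> 1" by simp
    note bounds = sum_off_diagonal_bound[OF a_nonzero[OF n] P[OF n] integer_coeffs[OF n] simple_zeros[OF n] conjunct2[OF elim]]
    have "inj_on (x n) {..<n}"
      using simple_zeros[OF n] unfolding P[OF n] by (rule rsquarefree_prod_linear_imp_inj)
    from sum_cut_kernel_le[OF this bounds] bounds(1) n show ?case by blast
  qed
  have ev_log: "\<forall>\<^sub>F n in F. integrable (\<mu> n) log_plus \<and> (\<integral>z. log_plus z \<partial>\<mu> n) \<le> c"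
    if "ln H < c" for c
    using ev_bounds[OF that]
    by eventually_elim
       (auto simp: \<mu>_def x_def normalized_counting_measure_props pos_divide_le_eq mult.commute)
  have ev_kernel: "\<forall>\<^sub>F n in F. (\<integral>z. \<integral>t. cut_kernel m z t \<partial>\<mu> n \<partial>\<mu> n) \<le> c"
    if c: "ln 2 + 2 * ln H < c" for m c
  proof -
    \<comment> \<open>The gap between \<open>ln 2 + 2 * d\<close> and \<open>c\<close> absorbs the
      diagonal contribution \<open>C / real n\<close>, where \<open>C\<close> depends on the
      truncation level \<open>m\<close> but not on \<open>n\<close>.\<close>
    obtain d where d: "ln H < d" "ln 2 + 2 * d < c"
    proof -
      have "ln H < (c - ln 2) / 2" using c by simp
      then obtain d where "ln H < d" "d < (c - ln 2) / 2" using dense by blast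
      then show ?thesis using that[of d] by simp
    qed
    define C where "C = ln 2 + 2 * d + ln (real (Suc m))"
    have "(\<lambda>n. ln 2 + 2 * d + C / real n) \<longlonglongrightarrow> ln 2 + 2 * d" by real_asymp
    then have "\<forall>\<^sub>F n in sequentially. ln 2 + 2 * d + C / real n < c"
      using d(2) by (rule order_tendstoD(2))
    then have "\<forall>\<^sub>F n in F. ln 2 + 2 * d + C / real n < c"
      unfolding F_def by (rule filter_leD[OF inf_le1])
    then show ?thesis
      using ev_bounds[OF d(1)]
    proof eventually_elim
      case (elim n)
      have "(\<integral>z. \<integral>t. cut_kernel m z t \<partial>\<mu> n \<partial>\<mu> n) = (\<Sum>j<n. \<Sum>k<n. cut_kernel m (x n j) (x n k)) / (real n)\<^sup>2"
        using elim continuous_on_cut_kernel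
        by (simp add: \<mu>_def x_def double_integral_normalized_counting_measure)
      also have "\<dots> \<le> ((real n)\<^sup>2 * (ln 2 + 2 * d) + real n * C) / (real n)\<^sup>2"
        using elim unfolding C_def by (intro divide_right_mono) auto
      also have "\<dots> = ln 2 + 2 * d + C / real n"
        using elim by (simp add: add_divide_distrib power2_eq_square)
      finally show ?case using elim by linarith
    qed
  qed
  have mass: "emeasure \<tau> UNIV = 1"
    using ev_log[of "ln H + 1"]
    by (intro weak_star_limit_mass[OF conv F prob borel_\<tau> locally_finite_\<tau>]) auto
  have space: "space \<tau> = UNIV" using sets_eq_imp_space_eq[OF borel_\<tau>] by simp
  interpret prob_space \<tau> by (rule prob_spaceI) (simp add: space mass)
  have L: "(\<integral>\<^sup>+z. ennreal (log_plus z) \<partial>\<tau>) \<le> ennreal (ln H)"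
  proof (rule ennreal_le_epsilon)
    fix e :: real assume "0 < e"
    have "(\<integral>\<^sup>+z. ennreal (log_plus z) \<partial>\<tau>) \<le> ennreal (ln H + e)"
      using \<open>0 < e\<close>
      by (intro weak_star_nn_integral_le[OF conv F borel_\<tau> locally_finite_\<tau>] ev_log log_plus_nonneg)
         (auto intro!: continuous_intros)
    then show "(\<integral>\<^sup>+z. ennreal (log_plus z) \<partial>\<tau>) \<le> ennreal (ln H) + ennreal e"
      using h \<open>0 < e\<close> by simp
  qed
  have W: "(\<integral>\<^sup>+z. \<integral>\<^sup>+t. energy_kernel z t \<partial>\<tau> \<partial>\<tau>) \<le> ennreal (ln 2 + 2 * ln H)"
    using ev_kernel by (rule weak_star_energy_le[OF conv F prob finite_measure_axioms borel_\<tau>])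
  note bounds = log_energy_restrict_bounds[OF borel_\<tau> mass _ h L W]
  \<comment> \<open>Taking the whole plane as the set of restriction turns the bounds into
    finiteness of the energy of \<open>\<tau>\<close> itself.\<close>
  have "restrict_space \<tau> UNIV = \<tau>"
    by (rule measure_eqI) (simp_all add: sets_restrict_space emeasure_restrict_space space borel_\<tau>)
  then have finite_energy: "\<bar>log_energy \<tau>\<bar> \<noteq> \<infinity>"
    using bounds[of UNIV] by auto
  have "enn2ereal (\<integral>\<^sup>+z. ennreal (log_plus z) \<partial>\<tau>) \<le> enn2ereal (ennreal (ln H))"
    using L by (simp add: less_eq_ennreal.rep_eq)
  then have log_bound: "enn2ereal (\<integral>\<^sup>+z. ennreal (max 0 (ln (cmod z))) \<partial>\<tau>) \<le> ereal (ln H)"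
    using h by (simp add: log_plus_eq)
  \<comment> \<open>The upper bound first appears with the mass of the closed disc. Passing to the
    smaller mass of the open disc weakens it, and the set of exceptional radii turns out to be
    empty.\<close>
  have "ereal (- ln 2 - 2 * measure \<tau> (cball 0 R) * ln H) \<le> log_energy (restrict_space \<tau> (cball 0 R)) \<and>
      log_energy (restrict_space \<tau> (cball 0 R)) \<le> ereal ((1 - measure \<tau> (ball 0 R)) * ln 4 + 2 * ln H)" for R
  proof -
    obtain e where e: "log_energy (restrict_space \<tau> (cball 0 R)) = ereal e"
      "- ln 2 - 2 * measure \<tau> (cball 0 R) * ln H \<le> e"
      "e \<le> (1 - measure \<tau> (cball 0 R)) * ln 4 + 2 * ln H"
      using bounds[of "cball 0 R"] by auto
    have "measure \<tau> (ball 0 R) \<le> measure \<tau> (cball 0 R)"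
      by (rule finite_measure_mono) (auto simp: borel_\<tau>)
    then have "(1 - measure \<tau> (cball 0 R)) * ln 4 \<le> (1 - measure \<tau> (ball 0 R)) * ln 4"
      by (intro mult_right_mono) auto
    with e(3) have "e \<le> (1 - measure \<tau> (ball 0 R)) * ln 4 + 2 * ln H" by linarith
    with e(1,2) show ?thesis by simp
  qed
  then show ?thesis
    using mass finite_energy log_bound by simp
qed

end
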